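(* Let $X$ be a finite-dimensional Banach space, let $E$ be a direction set in $X$, and let $\mathcal{F}$ be a complete, symmetric, simplicial $E$-fan. Then $\mathcal{R}(\mathcal{F})\subset\mathcal{R}(E)$ and $\mathcal{N}(\mathcal{F})\subset\mathcal{N}(E)$. Moreover, the map $\phi_E:\mathcal{R}(E)\to\mathcal{N}(E)$, $\phi_E(\alpha)=\rho(\cdot;\alpha E)$, is bijective, and its restriction $\phi_{\mathcal{F}}:\mathcal{R}(\mathcal{F})\to\mathcal{N}(\mathcal{F})$, $\phi_{\mathcal{F}}(\alpha)=\rho(\cdot;\alpha E)$, is also bijective.
   Context: $\mathcal{N}(X)$ is the set of equivalent norms on $X$, $B_p=\{x: p(x)\le1\}$, and $d=\dim X$. A direction set in $(X,\|\cdot\|)$ is a finite subset $E\subset S_X$ of the unit sphere with $E=-E$ and $\operatorname{conv}(E)$ having nonempty interior; choosing one representative from each antipodal pair, write $E=\{\pm x_1,\dots,\pm x_n\}$ (cardinality $2n$). $\operatorname{Dir}(E)=\{cx:c>0,x\in E\}$; $\operatorname{Ext}$ denotes the set of extreme points. For $\alpha=(\alpha_1,\dots,\alpha_n)\in\mathbb{R}^n_{>0}$, $\operatorname{conv}(\alpha E)=\operatorname{conv}\{\pm\alpha_1^{-1}x_1,\dots,\pm\alpha_n^{-1}x_n\}$ and $\rho(x;\alpha E)=\inf\{r>0:x\in r\operatorname{conv}(\alpha E)\}$. The multiindex $\alpha$ is $E$-admissible if for every $i$ and every $0<\varepsilon_i<\alpha_i$, with $\alpha'=(\alpha_1,\dots,\alpha_i-\varepsilon_i,\dots,\alpha_n)$,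 one has $\rho(\cdot;\alpha'E)\ne\rho(\cdot;\alpha E)$. A fan $\mathcal{F}$ in $X$ is a finite collection of polyhedral cones, closed under taking faces, such that the intersection of any two of its cones is a face of both. It is simplicial if every cone is generated by a linearly independent set, complete if its cones cover $X$, symmetric if $-C\in\mathcal{F}$ whenever $C\in\mathcal{F}$, and an $E$-fan if every cone of $\mathcal{F}$ is generated by rays determined by elements of $E$. For a complete, symmetric, simplicial $E$-fan $\mathcal{F}$ and a symmetric weight $\alpha:E\to(0,\infty)$ (i.e. $\alpha(-x)=\alpha(x)$), the pair $(\mathcal{F},\alpha)$ is $E$-admissible if for every maximal cone $C=\operatorname{cone}(x_{n_1},\dots,x_{n_d})\in\mathcal{F}$ (generators in $E$) the unique $\ell_C^\alpha\in X^*$ with $\ell_C^\alpha(x_{n_k})=\alpha(x_{n_k})$, $k=1,\dots,d$, satisfies $\ell_C^\alpha(x_i)\le\alpha(x_i)$ for every $x_i\in E$. Symmetric weights on $E$ are identified with multiindices via $\alpha\leftrightarrow(\alpha(x_1),\dots,\alpha(x_n))\in\mathbb{R}^n_{>0}$. Definitions of the models: $\mathcal{N}(E)=\{p\in\mathcal{N}(X):\operatorname{Ext}(B_p)\subset\operatorname{Dir}(E)\}$; $\mathcal{R}(E)=\{\alpha\in\mathbb{R}^n_{>0}:\alpha\text{ is }E\text{-admissible}\}$; $\mathcal{N}(\mathcal{F})=\{p\in\mathcal{N}(X): p\text{ is linear on every cone }C\in\mathcal{F}\}$ (linear on $C$ means coinciding on $C$ with a linear functional); $\mathcal{R}(\mathcal{F})=\{\alpha:E\to(0,\infty):\alpha(-x)=\alpha(x)\text{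 and }(\mathcal{F},\alpha)\text{ is }E\text{-admissible}\}$.
   Formalization: An E-fan is also required to contain the ray of every element of E; otherwise the claim fails (quadrant fan in the plane, E = {±e1, ±e2, ±(e1+e2)/√2}: the weights (1,1,t), t ≥ √2, all lie in R(F) and give the same norm). *)

theory Defs
  imports "HOL-Analysis.Analysis"
begin

section \<open>Equivalent norms\<close>

definition finite_dimensional :: "'a::real_vector itself \<Rightarrow> bool" where
  "finite_dimensional _ \<longleftrightarrow> (\<exists>B :: 'a set. finite B \<and> span B = UNIV)"

definition is_norm :: "('a::real_vector \<Rightarrow> real) \<Rightarrow> bool" where
  "is_norm p \<longleftrightarrow>
     (\<forall>x. 0 \<le> p x) \<and> (\<forall>x. p x = 0 \<longleftrightarrow> x = 0) \<and>
     (\<forall>c x. p (c *\<^sub>R x) = \<bar>c\<bar> * p x) \<and> (\<forall>x y. p (x + y) \<le> p x + p y)"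

definition equivalent_norms :: "('a::real_normed_vector \<Rightarrow> real) set" where
  "equivalent_norms =
     {p. is_norm p \<and> (\<exists>c>0. \<exists>C>0. \<forall>x. c * norm x \<le> p x \<and> p x \<le> C * norm x)}"

definition unit_ball :: "('a \<Rightarrow> real) \<Rightarrow> 'a set" where
  "unit_ball p = {x. p x \<le> 1}"

definition Ext :: "'a::real_vector set \<Rightarrow> 'a set" where
  "Ext S = {v. v extreme_point_of S}"


section \<open>Direction sets and multiindices\<close>

definition direction_set :: "'a::real_normed_vector set \<Rightarrow> bool" where
  "direction_set E \<longleftrightarrow>
     finite E \<and> E \<subseteq> sphere 0 1 \<and> uminus ` E = E \<and> interior (convex hull E) \<noteq> {}"

text \<open>
  The family \<open>x\<close> lists one representative of every antipodal pair of \<open>E\<close>, so that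
  \<open>E = {\<plusminus>x\<^sub>1, \<dots>, \<plusminus>x\<^sub>n}\<close> has \<open>2n\<close> elements. The index set \<open>{1, \<dots>, n}\<close> is an arbitrary finite
  type \<open>'n\<close> with \<open>n = CARD('n)\<close>, and multiindices are vectors of type \<open>real ^ 'n\<close>.
\<close>

definition antipodal_reps :: "('n::finite \<Rightarrow> 'a::real_vector) \<Rightarrow> 'a set \<Rightarrow> bool" where
  "antipodal_reps x E \<longleftrightarrow>
     E = range x \<union> uminus ` range x \<and> inj x \<and> range x \<inter> uminus ` range x = {}"

definition Dir :: "'a::real_vector set \<Rightarrow> 'a set" where
  "Dir E = {c *\<^sub>R v | c v. c > 0 \<and> v \<in> E}"

definition weighted_hull :: "('n::finite \<Rightarrow> 'a::real_vector) \<Rightarrow> real ^ 'n \<Rightarrow> 'a set" where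
  "weighted_hull x \<alpha> =
     convex hull ((\<Union>i. {inverse (\<alpha> $ i) *\<^sub>R x i, - (inverse (\<alpha> $ i) *\<^sub>R x i)}))"

definition rho :: "('n::finite \<Rightarrow> 'a::real_vector) \<Rightarrow> real ^ 'n \<Rightarrow> 'a \<Rightarrow> real" where
  "rho x \<alpha> v = Inf {r. r > 0 \<and> v \<in> (\<lambda>u. r *\<^sub>R u) ` weighted_hull x \<alpha>}"

definition admissible_multiindex :: "('n::finite \<Rightarrow> 'a::real_vector) \<Rightarrow> real ^ 'n \<Rightarrow> bool" where
  "admissible_multiindex x \<alpha> \<longleftrightarrow>
     (\<forall>i \<epsilon>. 0 < \<epsilon> \<and> \<epsilon> < \<alpha> $ i \<longrightarrow> rho x (\<chi> j. if j = i then \<alpha> $ j - \<epsilon> else \<alpha> $ j) \<noteq> rho x \<alpha>)"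

definition norms_E :: "'a::real_normed_vector set \<Rightarrow> ('a \<Rightarrow> real) set" where
  "norms_E E = {p \<in> equivalent_norms. Ext (unit_ball p) \<subseteq> Dir E}"

definition indices_E :: "('n::finite \<Rightarrow> 'a::real_vector) \<Rightarrow> (real ^ 'n) set" where
  "indices_E x = {\<alpha>. (\<forall>i. \<alpha> $ i > 0) \<and> admissible_multiindex x \<alpha>}"


section \<open>Fans\<close>

text \<open>
  Polyhedral cones are the finitely generated ones; the cone generated by the empty set is \<open>{0}\<close>.
\<close>

definition polyhedral_cone :: "'a::real_vector set \<Rightarrow> bool" where
  "polyhedral_cone C \<longleftrightarrow> (\<exists>G. finite G \<and> C = convex_cone hull G)"

text \<open>
  The relation \<open>face_of\<close> also counts the empty set as a face, which is not a cone and is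
  therefore excluded from the closure condition. Two cones always meet in \<open>0\<close>, so this
  plays no role for intersections.
\<close>

definition fan :: "'a::real_vector set set \<Rightarrow> bool" where
  "fan F \<longleftrightarrow>
     finite F \<and> (\<forall>C\<in>F. polyhedral_cone C) \<and>
     (\<forall>C\<in>F. \<forall>T. T face_of C \<and> T \<noteq> {} \<longrightarrow> T \<in> F) \<and>
     (\<forall>C\<in>F. \<forall>D\<in>F. (C \<inter> D) face_of C \<and> (C \<inter> D) face_of D)"

definition simplicial_fan :: "'a::real_vector set set \<Rightarrow> bool" where
  "simplicial_fan F \<longleftrightarrow> fan F \<and> (\<forall>C\<in>F. \<exists>G. independent G \<and> C = convex_cone hull G)"

definition complete_fan :: "'a::real_vector set set \<Rightarrow> bool" where
  "complete_fan F \<longleftrightarrow> fan F \<and> \<Union>F = UNIV"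

definition symmetric_fan :: "'a::real_vector set set \<Rightarrow> bool" where
  "symmetric_fan F \<longleftrightarrow> fan F \<and> (\<forall>C\<in>F. uminus ` C \<in> F)"

text \<open>
  The rays of an \<open>E\<close>-fan are the rays determined by the elements of \<open>E\<close>: every cone is generated
  by some of them, and each of them occurs in the fan. If an antipodal pair \<open>\<plusminus>u\<close> of \<open>E\<close> did not span
  rays of the fan, then \<open>admissible_pair\<close> would only bound the weight of \<open>u\<close> from below. For the
  quadrant fan of the plane and \<open>E = {\<plusminus>e\<^sub>1, \<plusminus>e\<^sub>2, \<plusminus>u}\<close> with \<open>u = (e\<^sub>1 + e\<^sub>2)/\<surd>2\<close>, the weights
  \<open>(1, 1, t)\<close> with \<open>t \<ge> \<surd>2\<close> would all be admissible and all define the \<open>\<ell>\<^sup>1\<close>-norm.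
\<close>

definition E_fan :: "'a::real_vector set \<Rightarrow> 'a set set \<Rightarrow> bool" where
  "E_fan E F \<longleftrightarrow> fan F \<and> (\<forall>C\<in>F. \<exists>G\<subseteq>E. C = convex_cone hull G) \<and>
     (\<forall>v\<in>E. convex_cone hull {v} \<in> F)"

definition maximal_cone :: "'a set set \<Rightarrow> 'a set \<Rightarrow> bool" where
  "maximal_cone F C \<longleftrightarrow> C \<in> F \<and> (\<forall>D\<in>F. C \<subseteq> D \<longrightarrow> D = C)"

text \<open>
  For a basis \<open>G\<close> this is the linear functional that agrees with \<open>w\<close> on \<open>G\<close>; see \<open>ell_unique\<close>.
\<close>

definition ell :: "'a::real_vector set \<Rightarrow> ('a \<Rightarrow> real) \<Rightarrow> 'a \<Rightarrow> real" where
  "ell G w = (THE l. linear l \<and> (\<forall>v\<in>G. l v = w v))"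

definition admissible_pair :: "'a::real_vector set \<Rightarrow> 'a set set \<Rightarrow> ('a \<Rightarrow> real) \<Rightarrow> bool" where
  "admissible_pair E F w \<longleftrightarrow>
     (\<forall>C G. maximal_cone F C \<and> G \<subseteq> E \<and> independent G \<and> card G = dim (UNIV :: 'a set) \<and>
            C = convex_cone hull G \<longrightarrow>
        (\<forall>v\<in>E. ell G w v \<le> w v))"

text \<open>
  Weights are functions on \<open>E\<close> only, hence extensional: \<open>E \<rightarrow>\<^sub>E {0<..}\<close>.
\<close>

definition symmetric_weights :: "'a::real_vector set \<Rightarrow> ('a \<Rightarrow> real) set" where
  "symmetric_weights E = {w \<in> E \<rightarrow>\<^sub>E {0<..}. \<forall>v\<in>E. w (- v) = w v}"

definition norms_F :: "'a::real_normed_vector set set \<Rightarrow> ('a \<Rightarrow> real) set" where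
  "norms_F F = {p \<in> equivalent_norms. \<forall>C\<in>F. \<exists>l. linear l \<and> (\<forall>v\<in>C. p v = l v)}"

definition weights_F :: "'a::real_vector set \<Rightarrow> 'a set set \<Rightarrow> ('a \<Rightarrow> real) set" where
  "weights_F E F = {w \<in> symmetric_weights E. admissible_pair E F w}"

text \<open>
  The identification of symmetric weights with multiindices; see \<open>bij_betw_multiindex\<close>.
\<close>

definition multiindex :: "('n::finite \<Rightarrow> 'a) \<Rightarrow> ('a \<Rightarrow> real) \<Rightarrow> real ^ 'n" where
  "multiindex x w = (\<chi> i. w (x i))"


section \<open>The maps between the models\<close>

definition phi_E :: "('n::finite \<Rightarrow> 'a::real_vector) \<Rightarrow> real ^ 'n \<Rightarrow> 'a \<Rightarrow> real" where
  "phi_E x \<alpha> = rho x \<alpha>"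

definition phi_F :: "('n::finite \<Rightarrow> 'a::real_vector) \<Rightarrow> ('a \<Rightarrow> real) \<Rightarrow> 'a \<Rightarrow> real" where
  "phi_F x w = phi_E x (multiindex x w)"


section \<open>Consistency of the encodings\<close>

lemma ell_unique:
  fixes G :: "'a::real_vector set" and w :: "'a \<Rightarrow> real"
  assumes "finite_dimensional TYPE('a)" "independent G" "card G = dim (UNIV :: 'a set)"
  shows "\<exists>!l. linear l \<and> (\<forall>v\<in>G. l v = w v)"
proof -
  obtain B :: "'a set" where B: "finite B" "span B = UNIV"
    using assms(1) by (auto simp: finite_dimensional_def)
  obtain H where H: "G \<subseteq> H" "independent H" "UNIV \<subseteq> span H"
    using maximal_independent_subset_extend[OF subset_UNIV assms(2)] by metis
  have finH: "finite H"
    using independent_span_bound[OF B(1) H(2)] B(2) by auto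
  have "dim (UNIV :: 'a set) = card H"
    using H dim_eq_card[of H UNIV] by auto
  hence "G = H"
    using H(1) finH assms(3) by (simp add: card_subset_eq)
  hence spanG: "span G = UNIV" using H(3) by auto
  obtain l where l: "linear l" "\<forall>v\<in>G. l v = w v"
    using linear_independent_extend[OF assms(2), of w] by blast
  have "l' = l" if l': "linear l'" "\<forall>v\<in>G. l' v = w v" for l'
    using linear_eq_on_span[OF l'(1) l(1), of G] l(2) l'(2) spanG by auto
  thus ?thesis using l by blast
qed

lemma bij_betw_multiindex:
  fixes x :: "'n::finite \<Rightarrow> 'a::real_vector"
  assumes "antipodal_reps x E"
  shows "bij_betw (multiindex x) (symmetric_weights E) {\<alpha>. \<forall>i. \<alpha> $ i > 0}"
proof (rule bij_betwI')
  have E: "E = range x \<union> uminus ` range x" and inj: "inj x"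
    and disj: "range x \<inter> uminus ` range x = {}"
    using assms by (auto simp: antipodal_reps_def)
  fix w w' assume w: "w \<in> symmetric_weights E" and w': "w' \<in> symmetric_weights E"
  show "(multiindex x w = multiindex x w') = (w = w')"
  proof
    assume "multiindex x w = multiindex x w'"
    hence eq: "w (x i) = w' (x i)" for i by (simp add: multiindex_def vec_eq_iff)
    show "w = w'"
    proof (rule PiE_ext[of _ E "\<lambda>_. {0<..}"])
      show "w \<in> E \<rightarrow>\<^sub>E {0<..}" "w' \<in> E \<rightarrow>\<^sub>E {0<..}"
        using w w' by (auto simp: symmetric_weights_def)
      fix v assume "v \<in> E"
      then consider i where "v = x i" | i where "v = - x i" using E by auto
      thus "w v = w' v"
      proof cases
        case 2
        moreover have "x i \<in> E" using E by auto
        ultimately show ?thesis using w w' eq by (simp add: symmetric_weights_def)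
      qed (simp add: eq)
    qed
  qed simp
next
  fix w assume "w \<in> symmetric_weights E"
  thus "multiindex x w \<in> {\<alpha>. \<forall>i. \<alpha> $ i > 0}"
    using assms by (auto simp: symmetric_weights_def multiindex_def antipodal_reps_def)
next
  have E: "E = range x \<union> uminus ` range x" and inj: "inj x"
    and disj: "range x \<inter> uminus ` range x = {}"
    using assms by (auto simp: antipodal_reps_def)
  fix \<alpha> :: "real ^ 'n" assume \<alpha>: "\<alpha> \<in> {\<alpha>. \<forall>i. \<alpha> $ i > 0}"
  define w where "w v = (if v \<in> range x then \<alpha> $ inv x v
    else if v \<in> uminus ` range x then \<alpha> $ inv x (- v) else undefined)" for v
  have 1: "w (x i) = \<alpha> $ i" for i using inj by (simp add: w_def)
  have 2: "w (- x i) = \<alpha> $ i" for i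
  proof -
    have "- x i \<notin> range x" using disj by blast
    thus ?thesis using inj by (simp add: w_def)
  qed
  have "w \<in> symmetric_weights E"
    unfolding symmetric_weights_def
  proof (intro CollectI conjI PiE_I ballI)
    fix v assume "v \<in> E"
    then consider i where "v = x i" | i where "v = - x i" using E by auto
    thus "w v \<in> {0<..}" "w (- v) = w v" using \<alpha> by (cases; auto simp: 1 2)+
  next
    fix v assume "v \<notin> E" thus "w v = undefined" using E by (simp add: w_def)
  qed
  moreover have "\<alpha> = multiindex x w" by (simp add: multiindex_def vec_eq_iff 1)
  ultimately show "\<exists>w\<in>symmetric_weights E. \<alpha> = multiindex x w" by blast
qed

end

theory Submission
  imports Defs
begin

text \<open>
  The function \<open>rho x \<alpha>\<close> is the gauge of the symmetric convex body spanned by the points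
  \<open>\<plusminus>x\<^sub>i/\<alpha>\<^sub>i\<close>, hence a norm whose unit ball is this body; the extreme points of the ball are among
  the spanning points. Its value at \<open>x\<^sub>i\<close> is at most \<open>\<alpha>\<^sub>i\<close>, and admissibility of \<open>\<alpha>\<close> means equality
  for all \<open>i\<close> (\<open>admissible_multiindex_iff\<close>): a strict inequality leaves room to lower \<open>\<alpha>\<^sub>i\<close> without
  changing the body. So an admissible \<open>\<alpha>\<close> is recovered from its norm as the vector of values at the
  \<open>x\<^sub>i\<close>. Conversely, let \<open>p\<close> be a norm whose extreme directions are in \<open>E\<close>. Each extreme point of
  its ball has norm one and is therefore of the form \<open>e/p(e)\<close>, and by Krein-Milman the ball
  is the weighted hull for the weights \<open>p(x\<^sub>i)\<close> (\<open>norms_E_eq_rho\<close>). This is the first bijection.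

  For the fan, the key fact is that maximal cones of a complete simplicial fan are spanned by bases
  (\<open>span_maximal_cone\<close>), so that a weight \<open>w\<close> defines a functional on each of them. If \<open>w\<close> is
  admissible, these functionals are bounded by the gauge everywhere, while on its own cone each one
  dominates the gauge by sublinearity; the gauge is thus linear on every cone (\<open>rho_eq_ell\<close>). Every
  element of \<open>E\<close> spans a ray of the fan and so is a generator of each cone that contains it
  (\<open>ray_mem_generators\<close>), which makes the gauge agree with \<open>w\<close> on \<open>E\<close>. In particular the multiindex
  of \<open>w\<close> is admissible and \<open>w\<close> is recovered by restriction to \<open>E\<close>. Conversely, for a norm that is
  linear on the cones, an extreme point of the ball is a convex combination of normalised generators
  of a cone containing it, so it is one of them; and the functional of a maximal cone, which agrees
  with the norm near an interior point of the cone, is below the norm by the triangle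
  inequality (\<open>restrict_norm_in_weights_F\<close>).
\<close>

section \<open>Norms and their unit balls\<close>

lemma is_normD:
  assumes "is_norm p"
  shows is_norm_nonneg: "0 \<le> p v"
    and is_norm_eq_0_iff: "p v = 0 \<longleftrightarrow> v = 0"
    and is_norm_scaleR: "p (c *\<^sub>R v) = \<bar>c\<bar> * p v"
    and is_norm_triangle: "p (u + v) \<le> p u + p v"
  using assms by (auto simp: is_norm_def)

lemma is_norm_minus: "is_norm p \<Longrightarrow> p (- v) = p v"
  using is_norm_scaleR[of p "-1" v] by simp

lemma is_norm_pos: "is_norm p \<Longrightarrow> v \<noteq> 0 \<Longrightarrow> 0 < p v"
  using is_norm_nonneg[of p v] is_norm_eq_0_iff[of p v] by linarith

lemma convex_on_is_norm:
  fixes p :: "'a::real_vector \<Rightarrow> real"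
  assumes "is_norm p"
  shows "convex_on UNIV p"
proof (rule convex_onI)
  fix t :: real and u v assume "0 < t" "t < 1"
  then show "p ((1 - t) *\<^sub>R u + t *\<^sub>R v) \<le> (1 - t) * p u + t * p v"
    using is_norm_triangle[OF assms, of "(1 - t) *\<^sub>R u" "t *\<^sub>R v"]
    by (simp add: is_norm_scaleR[OF assms])
qed simp

lemma convex_unit_ball:
  fixes p :: "'a::real_vector \<Rightarrow> real"
  assumes "is_norm p"
  shows "convex (unit_ball p)"
proof (rule convexI)
  fix u v :: 'a and s t :: real
  assume "u \<in> unit_ball p" "v \<in> unit_ball p" "0 \<le> s" "0 \<le> t" "s + t = 1"
  then have "s * p u + t * p v \<le> s + t"
    by (intro add_mono mult_left_le) (auto simp: unit_ball_def)
  then show "s *\<^sub>R u + t *\<^sub>R v \<in> unit_ball p"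
    using is_norm_triangle[OF assms, of "s *\<^sub>R u" "t *\<^sub>R v"] \<open>0 \<le> s\<close> \<open>0 \<le> t\<close> \<open>s + t = 1\<close>
    by (simp add: unit_ball_def is_norm_scaleR[OF assms])
qed

lemma scaled_in_unit_ball:
  assumes "is_norm p"
  shows "inverse (p v) *\<^sub>R v \<in> unit_ball p"
  by (cases "v = 0")
    (simp_all add: unit_ball_def is_norm_scaleR[OF assms] is_norm_eq_0_iff[OF assms]
      is_norm_nonneg[OF assms] is_norm_eq_0_iff[OF assms, THEN iffD2])

text \<open>
  A vector \<open>v\<close> with \<open>p v < 1\<close> is the midpoint of \<open>v + d\<close> and \<open>v - d\<close> for every small \<open>d\<close>. The
  nonzero vector \<open>e\<close> supplies such a \<open>d \<noteq> 0\<close>; in the trivial space the point \<open>0\<close> is extreme.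
\<close>

lemma norm_of_extreme_point:
  fixes p :: "'a::real_vector \<Rightarrow> real" and e :: 'a
  assumes p: "is_norm p" and e: "e \<noteq> 0" and v: "v extreme_point_of unit_ball p"
  shows "p v = 1"
proof (rule ccontr)
  assume "p v \<noteq> 1"
  moreover have "p v \<le> 1" using v by (simp add: extreme_point_of_def unit_ball_def)
  ultimately have lt: "p v < 1" by simp
  define d where "d = ((1 - p v) / p e) *\<^sub>R e"
  have pe: "p e > 0" using is_norm_pos[OF p e] .
  have d0: "d \<noteq> 0" using lt pe e by (simp add: d_def)
  have pd: "p d = 1 - p v" using lt pe by (simp add: d_def is_norm_scaleR[OF p])
  have "v + d \<in> unit_ball p" "v - d \<in> unit_ball p"
    using is_norm_triangle[OF p, of v d] is_norm_triangle[OF p, of v "- d"] pd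
    by (auto simp: unit_ball_def is_norm_minus[OF p])
  moreover have "v \<in> open_segment (v + d) (v - d)"
  proof -
    have "v = (1 - 1/2) *\<^sub>R (v + d) + (1/2) *\<^sub>R (v - d)"
      by (simp add: algebra_simps flip: scaleR_add_left)
    moreover have "v + d \<noteq> v - d"
    proof
      assume "v + d = v - d"
      then have "(2::real) *\<^sub>R d = 0" by (simp add: scaleR_2 algebra_simps)
      then show False using d0 by simp
    qed
    ultimately show ?thesis unfolding in_segment by (intro conjI exI[of _ "1/2"]) auto
  qed
  ultimately show False using v by (auto simp: extreme_point_of_def)
qed

lemma extreme_point_of_linear_image:
  assumes "linear f" "inj f"
  shows "f v extreme_point_of f ` S \<longleftrightarrow> v extreme_point_of S"
  using face_of_linear_image[OF assms, of "{v}" S] by (simp add: face_of_singleton)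

text \<open>
  A linear section \<open>f\<close> of the surjection \<open>L a = (\<Sum>i. a\<^sub>i x\<^sub>i)\<close> embeds the space into a Euclidean one,
  where the Krein-Milman theorem applies to the image of the unit ball. This image is compact: the
  norm transported by \<open>L\<close> is convex, hence continuous, and on the range of \<open>f\<close> its minimum
  over the Euclidean unit sphere is positive.
\<close>

lemma unit_ball_eq_convex_hull_Ext:
  fixes x :: "'n::finite \<Rightarrow> 'a::real_vector" and p :: "'a \<Rightarrow> real"
  assumes p: "is_norm p" and span: "span (range x) = UNIV"
  shows "unit_ball p = convex hull (Ext (unit_ball p))"
proof -
  define L :: "real^'n \<Rightarrow> 'a" where "L a = (\<Sum>i\<in>UNIV. a $ i *\<^sub>R x i)" for a
  have L: "linear L"
    by (rule linearI) (simp_all add: L_def scaleR_add_left sum.distrib scaleR_right.sum)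
  have Laxis: "L (axis i 1) = x i" for i
  proof -
    have "L (axis i 1) = (\<Sum>j\<in>UNIV. if j = i then x j else 0)"
      unfolding L_def by (intro sum.cong) (auto simp: axis_def)
    then show ?thesis by simp
  qed
  have "range x \<subseteq> range L" using Laxis by (metis image_subsetI rangeI)
  then have "surj L"
    using span_minimal[OF _ linear_subspace_image[OF L subspace_UNIV]] span by blast
  then obtain f where f: "linear f" and Lf: "L \<circ> f = id"
    using linear_surj_right_inverse[OF L] by (metis linear_surjective_right_inverse[OF L])
  have Lf': "L (f v) = v" for v using Lf by (metis comp_apply id_apply)
  have inj: "inj f" using Lf' by (metis injI)
  define K where "K = range f"
  have K: "subspace K" unfolding K_def using linear_subspace_image[OF f subspace_UNIV] .
  have clK: "closed K" using closed_subspace[OF K] .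
  define q where "q a = p (L a)" for a
  have "convex_on UNIV q"
  proof (rule convex_onI)
    fix t :: real and a b :: "real^'n" assume "0 < t" "t < 1"
    then show "q ((1 - t) *\<^sub>R a + t *\<^sub>R b) \<le> (1 - t) * q a + t * q b"
      using convex_onD[OF convex_on_is_norm[OF p], of t "L a" "L b"]
      by (simp add: q_def linear_add[OF L] linear_scale[OF L])
  qed simp
  then have cont: "continuous_on UNIV q"
    using convex_on_continuous[OF open_UNIV] by blast
  have qpos: "0 < q a" if "a \<in> K" "a \<noteq> 0" for a
  proof -
    obtain v where v: "a = f v" using \<open>a \<in> K\<close> K_def by auto
    then have "v \<noteq> 0" using that linear_0[OF f] by auto
    then show ?thesis unfolding q_def v Lf' by (rule is_norm_pos[OF p])
  qed
  have qscale: "q (c *\<^sub>R a) = \<bar>c\<bar> * q a" for c a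
    by (simp add: q_def linear_scale[OF L] is_norm_scaleR[OF p])
  \<comment> \<open>The constant is the minimum on the sphere; the sphere of a trivial range is empty.\<close>
  obtain m where m: "m > 0" "\<And>a. a \<in> K \<Longrightarrow> m * norm a \<le> q a"
  proof (cases "sphere 0 1 \<inter> K = {}")
    case True
    have "a = 0" if "a \<in> K" for a
    proof (rule ccontr)
      assume "a \<noteq> 0"
      then have "inverse (norm a) *\<^sub>R a \<in> sphere 0 1 \<inter> K"
        using subspace_scale[OF K that] by simp
      then show False using True by blast
    qed
    moreover have "norm (0 :: real^'n) \<le> q 0"
      by (simp add: q_def linear_0[OF L] is_norm_nonneg[OF p])
    ultimately have "1 * norm a \<le> q a" if "a \<in> K" for a using that by (metis mult_1)
    then show ?thesis by (intro that[of 1]) simp_all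
  next
    case False
    have "compact (sphere 0 1 \<inter> K)" using clK by (intro compact_Int_closed) auto
    then obtain a0 where a0: "a0 \<in> sphere 0 1 \<inter> K" "\<forall>a\<in>sphere 0 1 \<inter> K. q a0 \<le> q a"
      using continuous_attains_inf[OF _ False continuous_on_subset[OF cont]] by auto
    show ?thesis
    proof (rule that[of "q a0"])
      show "q a0 > 0" using a0(1) by (intro qpos) auto
      fix a assume a: "a \<in> K"
      show "q a0 * norm a \<le> q a"
      proof (cases "a = 0")
        case True
        then show ?thesis by (simp add: q_def linear_0[OF L] is_norm_nonneg[OF p])
      next
        case False
        then have "inverse (norm a) *\<^sub>R a \<in> sphere 0 1 \<inter> K"
          using subspace_scale[OF K a] by simp
        then have "q a0 \<le> q (inverse (norm a) *\<^sub>R a)" using a0(2) by blast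
        then show ?thesis using False by (simp add: qscale field_simps)
      qed
    qed
  qed
  have img: "f ` unit_ball p = K \<inter> {a. q a \<le> 1}"
    by (auto simp: K_def q_def unit_ball_def Lf')
  have "closed {a. q a \<le> 1}"
    using closed_Collect_le[OF cont continuous_on_const] .
  moreover have "bounded (K \<inter> {a. q a \<le> 1})"
  proof (rule boundedI[of _ "inverse m"])
    fix a assume "a \<in> K \<inter> {a. q a \<le> 1}"
    then have "m * norm a \<le> 1" using m(2)[of a] by auto
    then show "norm a \<le> inverse m" using m(1) by (simp add: field_simps)
  qed
  ultimately have "compact (f ` unit_ball p)"
    unfolding img using clK by (simp add: compact_eq_bounded_closed closed_Int)
  moreover have "convex (f ` unit_ball p)"
    using convex_linear_image[OF f convex_unit_ball[OF p]] .
  ultimately have "f ` unit_ball p = convex hull {a. a extreme_point_of f ` unit_ball p}"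
    by (rule Krein_Milman_Minkowski)
  also have "{a. a extreme_point_of f ` unit_ball p} = f ` Ext (unit_ball p)"
  proof -
    have "a \<in> f ` unit_ball p" if "a extreme_point_of f ` unit_ball p" for a
      using that by (simp add: extreme_point_of_def)
    then show ?thesis
      using extreme_point_of_linear_image[OF f inj] by (fastforce simp: Ext_def)
  qed
  also have "convex hull (f ` Ext (unit_ball p)) = f ` (convex hull Ext (unit_ball p))"
    by (rule convex_hull_linear_image[OF f, symmetric])
  finally show ?thesis using inj by (simp add: inj_image_eq_iff)
qed


section \<open>Gauges of symmetric convex bodies\<close>

text \<open>
  The function \<open>rho x \<alpha>\<close> is the gauge of \<open>weighted_hull x \<alpha>\<close>. Taking the set as the parameter
  allows weighted hulls to be compared with unit balls of arbitrary norms.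
\<close>

definition minkowski_gauge :: "'a::real_vector set \<Rightarrow> 'a \<Rightarrow> real" where
  "minkowski_gauge S v = Inf {r. r > 0 \<and> v \<in> (\<lambda>u. r *\<^sub>R u) ` S}"

lemma in_scaled_iff:
  fixes v :: "'a::real_vector"
  assumes "r \<noteq> 0"
  shows "v \<in> (\<lambda>u. r *\<^sub>R u) ` S \<longleftrightarrow> inverse r *\<^sub>R v \<in> S"
  using assms by (force simp: image_iff)

lemma gauge_le:
  assumes "r > 0" "inverse r *\<^sub>R v \<in> S"
  shows "minkowski_gauge S v \<le> r"
  unfolding minkowski_gauge_def using assms
  by (intro cInf_lower) (auto simp: in_scaled_iff intro: bdd_belowI[of _ 0])

lemma gauge_unit_ball:
  assumes p: "is_norm p"
  shows "minkowski_gauge (unit_ball p) = p"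
proof
  fix v
  have "{r. r > 0 \<and> v \<in> (\<lambda>u. r *\<^sub>R u) ` unit_ball p} = {r. r > 0 \<and> p v \<le> r}"
    by (auto simp: in_scaled_iff unit_ball_def is_norm_scaleR[OF p] field_simps)
  also have "Inf \<dots> = p v"
  proof (cases "p v = 0")
    case True
    then have "{r. r > 0 \<and> p v \<le> r} = {0<..}" by auto
    then show ?thesis using True by simp
  next
    case False
    then have "{r. r > 0 \<and> p v \<le> r} = {p v..}" using is_norm_nonneg[OF p, of v] by auto
    then show ?thesis by simp
  qed
  finally show "minkowski_gauge (unit_ball p) v = p v" by (simp add: minkowski_gauge_def)
qed

text \<open>
  The gauges of these sets are norms equivalent to the given one: the interior point makes them
  finite, symmetry and convexity give the norm axioms, and boundedness gives definiteness.
\<close>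

locale symmetric_convex_body =
  fixes S :: "'a::real_normed_vector set"
  assumes convex: "convex S"
    and minus: "v \<in> S \<Longrightarrow> - v \<in> S"
    and bounded: "bounded S"
    and zero_interior: "0 \<in> interior S"
begin

lemma zero_in: "0 \<in> S"
  using zero_interior interior_subset by blast

lemma scale_in: "v \<in> S \<Longrightarrow> \<bar>t\<bar> \<le> 1 \<Longrightarrow> t *\<^sub>R v \<in> S"
proof -
  assume v: "v \<in> S" and t: "\<bar>t\<bar> \<le> 1"
  have "(1 - \<bar>t\<bar>) *\<^sub>R 0 + \<bar>t\<bar> *\<^sub>R v \<in> S"
    using convexD_alt[OF convex zero_in v, of "\<bar>t\<bar>"] t by simp
  then show ?thesis using minus[of "\<bar>t\<bar> *\<^sub>R v"] by (cases "t \<ge> 0") auto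
qed

lemma gauge_upper: obtains C where "C > 0" "\<And>v. v \<noteq> 0 \<Longrightarrow> inverse (C * norm v) *\<^sub>R v \<in> S"
proof -
  obtain d where d: "d > 0" "cball 0 d \<subseteq> S"
    using zero_interior mem_interior_cball by blast
  show ?thesis
  proof (rule that[of "inverse d"])
    fix v :: 'a assume "v \<noteq> 0"
    then have "inverse (inverse d * norm v) *\<^sub>R v \<in> cball 0 d" using d(1) by simp
    then show "inverse (inverse d * norm v) *\<^sub>R v \<in> S" using d(2) by blast
  qed (use d in simp)
qed

lemma gauge_nonempty: "{r. r > 0 \<and> v \<in> (\<lambda>u. r *\<^sub>R u) ` S} \<noteq> {}"
proof (cases "v = 0")
  case True
  then have "1 \<in> {r. r > 0 \<and> v \<in> (\<lambda>u. r *\<^sub>R u) ` S}" using zero_in by force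
  then show ?thesis by blast
next
  case False
  obtain C where "C > 0" "\<And>v. v \<noteq> 0 \<Longrightarrow> inverse (C * norm v) *\<^sub>R v \<in> S"
    using gauge_upper by blast
  then have "C * norm v \<in> {r. r > 0 \<and> v \<in> (\<lambda>u. r *\<^sub>R u) ` S}"
    using False by (simp add: in_scaled_iff)
  then show ?thesis by blast
qed

lemma gauge_greatest:
  assumes "\<And>r. r > 0 \<Longrightarrow> inverse r *\<^sub>R v \<in> S \<Longrightarrow> m \<le> r"
  shows "m \<le> minkowski_gauge S v"
  unfolding minkowski_gauge_def using assms
  by (intro cInf_greatest gauge_nonempty) (auto simp: in_scaled_iff)

lemma gauge_nonneg: "0 \<le> minkowski_gauge S v"
  by (rule gauge_greatest) simp

lemma gauge_less_imp:
  assumes "minkowski_gauge S v < r"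
  shows "inverse r *\<^sub>R v \<in> S"
proof -
  obtain s where s: "s > 0" "inverse s *\<^sub>R v \<in> S" "s < r"
    using cInf_lessD[OF gauge_nonempty] assms unfolding minkowski_gauge_def by (force simp: in_scaled_iff)
  have "(s / r) *\<^sub>R (inverse s *\<^sub>R v) \<in> S" using s by (intro scale_in[OF s(2)]) auto
  moreover have "(s / r) *\<^sub>R (inverse s *\<^sub>R v) = inverse r *\<^sub>R v"
    using s by (simp add: field_simps)
  ultimately show ?thesis by metis
qed

lemma gauge_scale_le: "minkowski_gauge S (c *\<^sub>R v) \<le> \<bar>c\<bar> * minkowski_gauge S v"
proof (rule field_le_epsilon)
  fix e :: real assume e: "e > 0"
  \<comment> \<open>The denominator \<open>\<bar>c\<bar> + 1\<close> also covers \<open>c = 0\<close>.\<close>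
  define r where "r = minkowski_gauge S v + e / (\<bar>c\<bar> + 1)"
  have r: "minkowski_gauge S v < r" "r > 0" using e gauge_nonneg[of v] by (auto simp: r_def add_nonneg_pos)
  have "\<bar>c\<bar> * (e / (\<bar>c\<bar> + 1)) < e" using e by (simp add: field_simps)
  then have cr: "\<bar>c\<bar> * r < \<bar>c\<bar> * minkowski_gauge S v + e" by (simp add: r_def distrib_left)
  define s where "s = \<bar>c\<bar> * minkowski_gauge S v + e"
  have s: "s > 0" "\<bar>c\<bar> * r < s" using e gauge_nonneg[of v] cr by (auto simp: s_def add_nonneg_pos)
  have "(c * r / s) *\<^sub>R (inverse r *\<^sub>R v) \<in> S"
    using s r by (intro scale_in gauge_less_imp[OF r(1)]) (auto simp: abs_mult)
  then have "inverse s *\<^sub>R (c *\<^sub>R v) \<in> S" using r by (simp add: field_simps)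
  then show "minkowski_gauge S (c *\<^sub>R v) \<le> \<bar>c\<bar> * minkowski_gauge S v + e" using gauge_le s(1) s_def by blast
qed

lemma gauge_scale: "minkowski_gauge S (c *\<^sub>R v) = \<bar>c\<bar> * minkowski_gauge S v"
proof (cases "c = 0")
  case True
  then show ?thesis using gauge_scale_le[of 0 v] gauge_nonneg[of 0] by simp
next
  case False
  then have "minkowski_gauge S v \<le> \<bar>inverse c\<bar> * minkowski_gauge S (c *\<^sub>R v)"
    using gauge_scale_le[of "inverse c" "c *\<^sub>R v"] by simp
  then have "\<bar>c\<bar> * minkowski_gauge S v \<le> minkowski_gauge S (c *\<^sub>R v)" using False by (simp add: field_simps)
  then show ?thesis using gauge_scale_le[of c v] by simp
qed

lemma gauge_triangle: "minkowski_gauge S (u + v) \<le> minkowski_gauge S u + minkowski_gauge S v"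
proof (rule field_le_epsilon)
  fix e :: real assume e: "e > 0"
  define r s where "r = minkowski_gauge S u + e / 2" and "s = minkowski_gauge S v + e / 2"
  have rs: "minkowski_gauge S u < r" "minkowski_gauge S v < s" "r > 0" "s > 0"
    using e gauge_nonneg[of u] gauge_nonneg[of v] by (auto simp: r_def s_def)
  \<comment> \<open>\<open>(u + v)/(r + s)\<close> is a convex combination of \<open>u/r\<close> and \<open>v/s\<close>.\<close>
  have "(r / (r + s)) *\<^sub>R (inverse r *\<^sub>R u) + (s / (r + s)) *\<^sub>R (inverse s *\<^sub>R v) \<in> S"
    using rs by (intro convexD[OF convex] gauge_less_imp) (auto simp flip: add_divide_distrib)
  then have "inverse (r + s) *\<^sub>R (u + v) \<in> S"
    using rs by (simp add: scaleR_add_right field_simps)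
  then have "minkowski_gauge S (u + v) \<le> r + s" using rs by (intro gauge_le) auto
  then show "minkowski_gauge S (u + v) \<le> minkowski_gauge S u + minkowski_gauge S v + e" by (simp add: r_def s_def)
qed

text \<open>
  Boundedness of the body bounds the gauge from below, and a ball inside the body bounds it from
  above.
\<close>

lemma gauge_equivalent_norm: "minkowski_gauge S \<in> equivalent_norms"
proof -
  obtain M where M: "M > 0" "\<And>v. v \<in> S \<Longrightarrow> norm v \<le> M"
    using bounded bounded_pos by blast
  have lower: "inverse M * norm v \<le> minkowski_gauge S v" for v
  proof (rule gauge_greatest)
    fix r assume "r > 0" "inverse r *\<^sub>R v \<in> S"
    then have "inverse r * norm v \<le> M" using M(2)[of "inverse r *\<^sub>R v"] by simp
    then show "inverse M * norm v \<le> r" using M(1) \<open>r > 0\<close> by (simp add: field_simps)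
  qed
  have g0: "minkowski_gauge S 0 = 0" using gauge_scale[of 0 0] by simp
  obtain C where C: "C > 0" "\<And>v. v \<noteq> 0 \<Longrightarrow> inverse (C * norm v) *\<^sub>R v \<in> S"
    using gauge_upper by blast
  have upper: "minkowski_gauge S v \<le> C * norm v" for v
    using C g0 by (cases "v = 0") (auto intro: gauge_le)
  have "minkowski_gauge S v = 0 \<longleftrightarrow> v = 0" for v
  proof
    assume "minkowski_gauge S v = 0"
    then have "inverse M * norm v \<le> 0" using lower[of v] by simp
    then show "v = 0" using M(1) by (simp add: mult_le_0_iff)
  qed (simp add: g0)
  then have "is_norm (minkowski_gauge S)"
    by (simp add: is_norm_def gauge_nonneg gauge_scale gauge_triangle)
  then show ?thesis
    using lower upper C(1) M(1) unfolding equivalent_norms_def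
    by (intro CollectI conjI exI[of _ "inverse M"] exI[of _ C]) auto
qed

lemma unit_ball_gauge:
  assumes "closed S"
  shows "unit_ball (minkowski_gauge S) = S"
proof
  show "S \<subseteq> unit_ball (minkowski_gauge S)" using gauge_le[of 1] by (auto simp: unit_ball_def)
  show "unit_ball (minkowski_gauge S) \<subseteq> S"
  proof
    fix v assume "v \<in> unit_ball (minkowski_gauge S)"
    then have le: "minkowski_gauge S v \<le> 1" by (simp add: unit_ball_def)
    have "inverse (1 + inverse (real (Suc n))) *\<^sub>R v \<in> S" for n
      using le by (intro gauge_less_imp) (smt (verit) inverse_positive_iff_positive of_nat_0_less_iff zero_less_Suc)
    moreover have "(\<lambda>n. inverse (1 + inverse (real (Suc n))) *\<^sub>R v) \<longlonglongrightarrow> inverse (1 + 0) *\<^sub>R v"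
      by (intro tendsto_intros LIMSEQ_inverse_real_of_nat) auto
    ultimately have "inverse (1 + 0 :: real) *\<^sub>R v \<in> S"
      by (rule closed_sequentially[OF assms])
    then show "v \<in> S" by simp
  qed
qed

end


section \<open>Weighted hulls\<close>

lemma direction_set_cball:
  assumes "direction_set E"
  obtains z d where "d > 0" "cball z d \<subseteq> convex hull E"
proof -
  have "interior (convex hull E) \<noteq> {}" using assms by (simp add: direction_set_def)
  then obtain z where "z \<in> interior (convex hull E)" by auto
  then show ?thesis using that by (auto simp: mem_interior_cball)
qed

lemma direction_set_span:
  fixes E :: "'a::real_normed_vector set"
  assumes "direction_set E"
  shows "span E = UNIV"
proof -
  obtain z d where d: "d > 0" "cball z d \<subseteq> convex hull E"
    using direction_set_cball[OF assms] .
  have hull: "convex hull E \<subseteq> span E"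
    by (intro hull_minimal span_superset subspace_imp_convex subspace_span)
  have "v \<in> span E" for v
  proof (cases "v = 0")
    case False
    define t where "t = d / norm v"
    have t: "t > 0" using d(1) False by (simp add: t_def)
    have "z + t *\<^sub>R v \<in> cball z d" "z \<in> cball z d" using d(1) False by (auto simp: t_def dist_norm)
    then have "z + t *\<^sub>R v \<in> span E" "z \<in> span E" using d(2) hull by blast+
    then have "(z + t *\<^sub>R v) - z \<in> span E" by (rule span_diff)
    then have "inverse t *\<^sub>R ((z + t *\<^sub>R v) - z) \<in> span E" by (rule span_scale)
    then show ?thesis using t by simp
  qed (simp add: span_zero)
  then show ?thesis by blast
qed

locale weighted_directions =
  fixes E :: "'a::real_normed_vector set" and x :: "'n::finite \<Rightarrow> 'a"
  assumes direction_set: "direction_set E"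
    and antipodal_reps: "antipodal_reps x E"
begin

lemma E_eq: "E = range x \<union> uminus ` range x"
  using antipodal_reps by (simp add: antipodal_reps_def)

lemma x_in_E: "x i \<in> E"
  by (simp add: E_eq)

lemma norm_E: "v \<in> E \<Longrightarrow> norm v = 1"
  using direction_set by (auto simp: direction_set_def)

lemma zero_notin_E: "0 \<notin> E"
  using norm_E by force

lemma finite_E: "finite E"
  using direction_set by (simp add: direction_set_def)

lemma span_reps: "span (range x) = UNIV"
proof -
  have "E \<subseteq> span (range x)" unfolding E_eq by (auto intro: span_base span_neg)
  then have "span E \<subseteq> span (range x)" by (rule span_minimal) simp
  then show ?thesis using direction_set_span[OF direction_set] by blast
qed

lemma rho_eq_gauge: "rho x \<alpha> = minkowski_gauge (weighted_hull x \<alpha>)"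
  by (simp add: fun_eq_iff rho_def minkowski_gauge_def)

lemma reps_in_weighted_hull: "inverse (\<alpha> $ i) *\<^sub>R x i \<in> weighted_hull x \<alpha>"
  unfolding weighted_hull_def by (rule hull_inc) blast

lemma weighted_hull_minimal:
  assumes "convex T" "\<And>i. inverse (\<alpha> $ i) *\<^sub>R x i \<in> T" "\<And>i. - (inverse (\<alpha> $ i) *\<^sub>R x i) \<in> T"
  shows "weighted_hull x \<alpha> \<subseteq> T"
  unfolding weighted_hull_def using assms by (intro hull_minimal) auto

lemma convex_weighted_hull: "convex (weighted_hull x \<alpha>)"
  by (simp add: weighted_hull_def)

lemma compact_weighted_hull: "compact (weighted_hull x \<alpha>)"
  unfolding weighted_hull_def by (intro finite_imp_compact_convex_hull) auto

lemma weighted_hull_minus: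
  assumes "v \<in> weighted_hull x \<alpha>"
  shows "- v \<in> weighted_hull x \<alpha>"
proof -
  have "weighted_hull x \<alpha> \<subseteq> uminus ` weighted_hull x \<alpha>"
  proof (rule weighted_hull_minimal)
    show "convex (uminus ` weighted_hull x \<alpha>)" by (rule convex_negations[OF convex_weighted_hull])
    have mem: "v \<in> uminus ` weighted_hull x \<alpha>" if "- v \<in> weighted_hull x \<alpha>" for v
      using imageI[OF that, of uminus] by simp
    show "inverse (\<alpha> $ i) *\<^sub>R x i \<in> uminus ` weighted_hull x \<alpha>" for i
      by (rule mem) (auto simp: weighted_hull_def intro!: hull_inc)
    show "- (inverse (\<alpha> $ i) *\<^sub>R x i) \<in> uminus ` weighted_hull x \<alpha>" for i
      by (rule mem) (simp add: reps_in_weighted_hull)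
  qed
  then obtain u where "u \<in> weighted_hull x \<alpha>" "v = - u" using assms by blast
  then show ?thesis by simp
qed

lemma weighted_hull_subset:
  assumes "\<And>i. inverse (\<alpha> $ i) *\<^sub>R x i \<in> weighted_hull x \<alpha>'"
  shows "weighted_hull x \<alpha> \<subseteq> weighted_hull x \<alpha>'"
  by (rule weighted_hull_minimal[OF convex_weighted_hull assms weighted_hull_minus[OF assms]])

lemma zero_in_weighted_hull: "0 \<in> weighted_hull x \<alpha>"
proof -
  fix i :: 'n
  let ?v = "inverse (\<alpha> $ i) *\<^sub>R x i"
  have "(1/2) *\<^sub>R ?v + (1/2) *\<^sub>R (- ?v) \<in> weighted_hull x \<alpha>"
    by (intro convexD[OF convex_weighted_hull] weighted_hull_minus[OF reps_in_weighted_hull]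
        reps_in_weighted_hull) auto
  then show ?thesis by simp
qed

text \<open>
  The hull of the unweighted directions has interior. A multiple of the weighted hull contains it,
  and by symmetry an interior point can be moved to the origin.
\<close>

lemma symmetric_convex_body_weighted_hull:
  assumes pos: "\<And>i. \<alpha> $ i > 0"
  shows "symmetric_convex_body (weighted_hull x \<alpha>)"
proof
  let ?S = "weighted_hull x \<alpha>"
  show "convex ?S" by (rule convex_weighted_hull)
  show "- v \<in> ?S" if "v \<in> ?S" for v using that by (rule weighted_hull_minus)
  show "bounded ?S" by (intro compact_imp_bounded compact_weighted_hull)
  define A where "A = (\<Sum>i\<in>UNIV. \<alpha> $ i)"
  have le: "\<alpha> $ i \<le> A" for i unfolding A_def using pos by (intro member_le_sum) (auto intro: less_imp_le)
  have A: "A > 0" using le pos less_le_trans by blast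
  let ?T = "(\<lambda>u. A *\<^sub>R u) ` ?S"
  have T: "convex ?T" by (rule convex_scaling[OF convex_weighted_hull])
  have Tminus: "- v \<in> ?T" if "v \<in> ?T" for v
    using that weighted_hull_minus by (force simp: image_iff)
  have xT: "x i \<in> ?T" for i
  proof -
    have "(1 - \<alpha> $ i / A) *\<^sub>R 0 + (\<alpha> $ i / A) *\<^sub>R (inverse (\<alpha> $ i) *\<^sub>R x i) \<in> ?S"
      using convexD_alt[OF convex_weighted_hull zero_in_weighted_hull reps_in_weighted_hull,
          of "\<alpha> $ i / A" \<alpha> i] le[of i] pos[of i] A by simp
    then have "inverse A *\<^sub>R x i \<in> ?S" using pos[of i] by (simp add: field_simps)
    then show ?thesis using A by (subst in_scaled_iff) auto
  qed
  then have "E \<subseteq> ?T" using Tminus unfolding E_eq by blast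
  then have "convex hull E \<subseteq> ?T" using T by (rule hull_minimal)
  moreover obtain z d where d: "d > 0" "cball z d \<subseteq> convex hull E"
    using direction_set_cball[OF direction_set] .
  ultimately have ball: "cball z d \<subseteq> ?T" by blast
  have "cball (0::'a) (d / A) \<subseteq> ?S"
  proof
    fix u :: 'a assume "u \<in> cball 0 (d / A)"
    then have "norm (A *\<^sub>R u) \<le> d" using A by (simp add: field_simps)
    then have "z + A *\<^sub>R u \<in> ?T" "z - A *\<^sub>R u \<in> ?T"
      using ball by (auto simp: subset_iff dist_norm)
    then have "(1/2) *\<^sub>R (z + A *\<^sub>R u) + (1/2) *\<^sub>R (- (z - A *\<^sub>R u)) \<in> ?T"
      by (intro convexD[OF T] Tminus[of "z - A *\<^sub>R u"]) auto
    then have "A *\<^sub>R u \<in> ?T" by (simp add: algebra_simps flip: scaleR_add_left)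
    then show "u \<in> ?S" using A by (subst (asm) in_scaled_iff) auto
  qed
  then show "0 \<in> interior ?S" using d(1) A by (meson divide_pos_pos mem_interior_cball)
qed

lemma rho_equivalent_norm:
  assumes "\<And>i. \<alpha> $ i > 0"
  shows "rho x \<alpha> \<in> equivalent_norms"
  unfolding rho_eq_gauge
  using symmetric_convex_body.gauge_equivalent_norm[OF symmetric_convex_body_weighted_hull[OF assms]] .

lemma unit_ball_rho:
  assumes "\<And>i. \<alpha> $ i > 0"
  shows "unit_ball (rho x \<alpha>) = weighted_hull x \<alpha>"
  unfolding rho_eq_gauge
  by (intro symmetric_convex_body.unit_ball_gauge symmetric_convex_body_weighted_hull assms
      compact_imp_closed compact_weighted_hull)

lemma rho_reps_le:
  assumes "\<alpha> $ i > 0"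
  shows "rho x \<alpha> (x i) \<le> \<alpha> $ i"
  unfolding rho_eq_gauge using assms by (intro gauge_le reps_in_weighted_hull)

text \<open>
  A functional that is at most \<open>1\<close> at the spanning points is at most \<open>1\<close> on their convex hull.
\<close>

lemma functional_le_rho:
  assumes pos: "\<And>i. \<alpha> $ i > 0" and l: "linear l" and le: "\<And>i. \<bar>l (x i)\<bar> \<le> \<alpha> $ i"
  shows "l v \<le> rho x \<alpha> v"
proof -
  interpret S: symmetric_convex_body "weighted_hull x \<alpha>"
    by (rule symmetric_convex_body_weighted_hull[OF pos])
  have "weighted_hull x \<alpha> \<subseteq> {u. l u \<le> 1}"
  proof (rule weighted_hull_minimal)
    show "convex {u. l u \<le> 1}"
    proof (rule convexI)
      fix u v :: 'a and s t :: real
      assume "u \<in> {u. l u \<le> 1}" "v \<in> {u. l u \<le> 1}" "0 \<le> s" "0 \<le> t" "s + t = 1"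
      then have "s * l u + t * l v \<le> s + t"
        by (intro add_mono mult_left_le) auto
      then show "s *\<^sub>R u + t *\<^sub>R v \<in> {u. l u \<le> 1}"
        using \<open>s + t = 1\<close> by (simp add: linear_add[OF l] linear_scale[OF l])
    qed
    show "inverse (\<alpha> $ i) *\<^sub>R x i \<in> {u. l u \<le> 1}" "- (inverse (\<alpha> $ i) *\<^sub>R x i) \<in> {u. l u \<le> 1}" for i
      using pos[of i] le[of i]
      by (auto simp: linear_scale[OF l] linear_neg[OF l] field_simps)
  qed
  then show ?thesis unfolding rho_eq_gauge
    by (intro S.gauge_greatest) (force simp: linear_scale[OF l] field_simps)
qed


section \<open>Admissible multiindices\<close>

text \<open>
  If \<open>rho x \<alpha> (x i) = \<beta> < \<alpha> $ i\<close>, then lowering the weight \<open>\<alpha> $ i\<close> to \<open>\<beta>\<close> moves the point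
  \<open>x\<^sub>i/\<alpha>\<^sub>i\<close> outwards to \<open>x\<^sub>i/\<beta>\<close>, which still belongs to the body, so that the hull stays the same.
  If the value at \<open>x\<^sub>i\<close> equals \<open>\<alpha> $ i\<close>, then every lower weight lowers this value.
\<close>

lemma admissible_multiindex_iff:
  assumes pos: "\<And>i. \<alpha> $ i > 0"
  shows "admissible_multiindex x \<alpha> \<longleftrightarrow> (\<forall>i. rho x \<alpha> (x i) = \<alpha> $ i)"
proof
  assume adm: "admissible_multiindex x \<alpha>"
  have norm: "is_norm (rho x \<alpha>)"
    using rho_equivalent_norm[of \<alpha>, OF pos] by (simp add: equivalent_norms_def)
  show "\<forall>i. rho x \<alpha> (x i) = \<alpha> $ i"
  proof (rule ccontr)
    assume "\<not> ?thesis"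
    then obtain i where "rho x \<alpha> (x i) \<noteq> \<alpha> $ i" by blast
    then have less: "rho x \<alpha> (x i) < \<alpha> $ i" using rho_reps_le[of \<alpha> i, OF pos] by simp
    define \<beta> where "\<beta> = rho x \<alpha> (x i)"
    have \<beta>: "0 < \<beta>" "\<beta> < \<alpha> $ i"
      using is_norm_pos[OF norm, of "x i"] x_in_E[of i] zero_notin_E less unfolding \<beta>_def by metis+
    define \<alpha>' where "\<alpha>' = (\<chi> j. if j = i then \<alpha> $ j - (\<alpha> $ i - \<beta>) else \<alpha> $ j)"
    have \<alpha>'i: "\<alpha>' $ i = \<beta>" and \<alpha>'j: "j \<noteq> i \<Longrightarrow> \<alpha>' $ j = \<alpha> $ j" for j
      by (simp_all add: \<alpha>'_def)
    have "weighted_hull x \<alpha>' = weighted_hull x \<alpha>"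
    proof
      have "inverse (\<alpha>' $ j) *\<^sub>R x j \<in> weighted_hull x \<alpha>" for j
      proof (cases "j = i")
        case True
        have "inverse \<beta> *\<^sub>R x i \<in> unit_ball (rho x \<alpha>)"
          unfolding \<beta>_def by (rule scaled_in_unit_ball[OF norm])
        then show ?thesis using True \<alpha>'i unit_ball_rho[of \<alpha>, OF pos] by simp
      qed (simp add: \<alpha>'j reps_in_weighted_hull)
      then show "weighted_hull x \<alpha>' \<subseteq> weighted_hull x \<alpha>"
        by (rule weighted_hull_subset)
      have "inverse (\<alpha> $ j) *\<^sub>R x j \<in> weighted_hull x \<alpha>'" for j
      proof (cases "j = i")
        case True
        have "(1 - \<beta> / \<alpha> $ i) *\<^sub>R 0 + (\<beta> / \<alpha> $ i) *\<^sub>R (inverse (\<alpha>' $ i) *\<^sub>R x i) \<in> weighted_hull x \<alpha>'"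
          using convexD_alt[OF convex_weighted_hull zero_in_weighted_hull reps_in_weighted_hull,
              of "\<beta> / \<alpha> $ i" \<alpha>' i] \<beta> by simp
        then show ?thesis using True \<beta> by (simp add: \<alpha>'i field_simps)
      qed (metis \<alpha>'j reps_in_weighted_hull)
      then show "weighted_hull x \<alpha> \<subseteq> weighted_hull x \<alpha>'"
        by (rule weighted_hull_subset)
    qed
    then have "rho x \<alpha>' = rho x \<alpha>" by (simp add: rho_eq_gauge)
    moreover have "rho x \<alpha>' \<noteq> rho x \<alpha>"
      using adm[unfolded admissible_multiindex_def, THEN spec[of _ i], THEN spec[of _ "\<alpha> $ i - \<beta>"]] \<beta>
      by (simp add: \<alpha>'_def)
    ultimately show False by blast
  qed
next
  assume eq: "\<forall>i. rho x \<alpha> (x i) = \<alpha> $ i"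
  show "admissible_multiindex x \<alpha>"
    unfolding admissible_multiindex_def
  proof (intro allI impI notI)
    fix i \<epsilon>
    let ?\<alpha>' = "\<chi> j. if j = i then \<alpha> $ j - \<epsilon> else \<alpha> $ j"
    assume \<epsilon>: "0 < \<epsilon> \<and> \<epsilon> < \<alpha> $ i" and "rho x ?\<alpha>' = rho x \<alpha>"
    moreover have "rho x ?\<alpha>' (x i) \<le> ?\<alpha>' $ i" using \<epsilon> by (intro rho_reps_le) simp
    ultimately have "\<alpha> $ i \<le> \<alpha> $ i - \<epsilon>" using eq by simp
    then show False using \<epsilon> by simp
  qed
qed

lemma indices_E_iff: "\<alpha> \<in> indices_E x \<longleftrightarrow> (\<forall>i. \<alpha> $ i > 0) \<and> (\<forall>i. rho x \<alpha> (x i) = \<alpha> $ i)"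
  using admissible_multiindex_iff[of \<alpha>] by (auto simp: indices_E_def)

lemma rho_in_norms_E:
  assumes pos: "\<And>i. \<alpha> $ i > 0"
  shows "rho x \<alpha> \<in> norms_E E"
proof -
  have "v \<in> Dir E" if "v extreme_point_of unit_ball (rho x \<alpha>)" for v
  proof -
    have "v \<in> (\<Union>i. {inverse (\<alpha> $ i) *\<^sub>R x i, - (inverse (\<alpha> $ i) *\<^sub>R x i)})"
      using that unfolding unit_ball_rho[of \<alpha>, OF pos] weighted_hull_def by (rule extreme_point_of_convex_hull)
    then obtain i where "v = inverse (\<alpha> $ i) *\<^sub>R x i \<or> v = inverse (\<alpha> $ i) *\<^sub>R (- x i)" by auto
    moreover have "x i \<in> E" "- x i \<in> E" by (auto simp: E_eq)
    ultimately show ?thesis using pos[of i] unfolding Dir_def by fastforce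
  qed
  then show ?thesis using rho_equivalent_norm[of \<alpha>, OF pos] by (auto simp: norms_E_def Ext_def)
qed

text \<open>
  An extreme point of the unit ball has norm one, so its direction \<open>e \<in> E\<close> determines it as
  \<open>e/p(e)\<close>, a spanning point of the weighted hull. By Krein-Milman the ball is contained in the hull.
\<close>

lemma norms_E_eq_rho:
  assumes "p \<in> norms_E E"
  shows "rho x (\<chi> i. p (x i)) = p"
proof -
  let ?\<alpha> = "\<chi> i. p (x i)"
  have p: "is_norm p" and ext: "Ext (unit_ball p) \<subseteq> Dir E"
    using assms by (auto simp: norms_E_def equivalent_norms_def)
  have "weighted_hull x ?\<alpha> \<subseteq> unit_ball p"
    using scaled_in_unit_ball[OF p] is_norm_minus[OF p]
    by (intro weighted_hull_minimal convex_unit_ball[OF p]) (auto simp: unit_ball_def)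
  moreover have "Ext (unit_ball p) \<subseteq> weighted_hull x ?\<alpha>"
  proof
    fix v assume v: "v \<in> Ext (unit_ball p)"
    then obtain c e where e: "v = c *\<^sub>R e" "c > 0" "e \<in> E" using ext by (auto simp: Dir_def)
    have e0: "e \<noteq> 0" using e(3) zero_notin_E by blast
    then have "p v = 1" using norm_of_extreme_point[OF p] v by (auto simp: Ext_def)
    then have "p e * c = 1" using e(2) by (simp add: e(1) is_norm_scaleR[OF p] mult.commute)
    then have c: "c = inverse (p e)" using inverse_unique by metis
    from e(3) obtain i where "e = x i \<or> e = - x i" unfolding E_eq by blast
    then show "v \<in> weighted_hull x ?\<alpha>"
      using reps_in_weighted_hull[of ?\<alpha> i] weighted_hull_minus[OF reps_in_weighted_hull[of ?\<alpha> i]]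
      by (auto simp: e(1) c is_norm_minus[OF p])
  qed
  then have "convex hull Ext (unit_ball p) \<subseteq> weighted_hull x ?\<alpha>"
    by (intro hull_minimal convex_weighted_hull)
  ultimately have "weighted_hull x ?\<alpha> = unit_ball p"
    using unit_ball_eq_convex_hull_Ext[OF p span_reps] by blast
  then show ?thesis by (simp add: rho_eq_gauge gauge_unit_ball[OF p])
qed

lemma norm_values_in_indices_E:
  assumes "p \<in> norms_E E"
  shows "(\<chi> i. p (x i)) \<in> indices_E x"
proof -
  have "is_norm p" using assms by (simp add: norms_E_def equivalent_norms_def)
  then have "p (x i) > 0" for i using is_norm_pos x_in_E[of i] zero_notin_E by metis
  then show ?thesis by (simp add: indices_E_iff norms_E_eq_rho[OF assms])
qed

lemma bij_betw_phi_E: "bij_betw (phi_E x) (indices_E x) (norms_E E)"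
proof (rule bij_betw_byWitness[where f' = "\<lambda>p. \<chi> i. p (x i)"])
  show "\<forall>\<alpha>\<in>indices_E x. (\<chi> i. phi_E x \<alpha> (x i)) = \<alpha>"
    by (simp add: indices_E_iff phi_E_def vec_eq_iff)
  show "\<forall>p\<in>norms_E E. phi_E x (\<chi> i. p (x i)) = p"
    by (simp add: phi_E_def norms_E_eq_rho)
  show "phi_E x ` indices_E x \<subseteq> norms_E E"
    by (auto simp: phi_E_def indices_E_iff intro: rho_in_norms_E)
  show "(\<lambda>p. \<chi> i. p (x i)) ` norms_E E \<subseteq> indices_E x"
    using norm_values_in_indices_E by blast
qed

end


section \<open>Finitely generated cones\<close>

lemma convex_cone_sum:
  assumes "convex_cone T" "\<And>g. g \<in> G \<Longrightarrow> f g \<in> T"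
  shows "sum f G \<in> T"
  using assms(2)
  by (induction G rule: infinite_finite_induct)
    (auto intro: convex_cone_add[OF assms(1)] convex_cone_contains_0[OF assms(1)])

lemma convex_cone_hull_finite:
  assumes "finite G"
  shows "convex_cone hull G = {\<Sum>g\<in>G. c g *\<^sub>R g | c. \<forall>g\<in>G. 0 \<le> c g}"
proof (rule hull_unique)
  show "G \<subseteq> {\<Sum>g\<in>G. c g *\<^sub>R g | c. \<forall>g\<in>G. 0 \<le> c g}"
  proof
    fix h assume "h \<in> G"
    then have "(\<Sum>g\<in>G. (if g = h then 1 else 0) *\<^sub>R g) = h"
      using assms by (simp add: if_distrib[of "\<lambda>c. c *\<^sub>R _"] cong: if_cong)
    then show "h \<in> {\<Sum>g\<in>G. c g *\<^sub>R g | c. \<forall>g\<in>G. 0 \<le> c g}"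
      by (intro CollectI exI[of _ "\<lambda>g. if g = h then 1 else 0"]) auto
  qed
  show "convex_cone {\<Sum>g\<in>G. c g *\<^sub>R g | c. \<forall>g\<in>G. 0 \<le> c g}"
    unfolding convex_cone_iff
  proof (intro conjI ballI allI impI)
    show "0 \<in> {\<Sum>g\<in>G. c g *\<^sub>R g | c. \<forall>g\<in>G. 0 \<le> c g}"
      by (intro CollectI exI[of _ "\<lambda>_. 0"]) auto
    fix u v assume "u \<in> {\<Sum>g\<in>G. c g *\<^sub>R g | c. \<forall>g\<in>G. 0 \<le> c g}"
      "v \<in> {\<Sum>g\<in>G. c g *\<^sub>R g | c. \<forall>g\<in>G. 0 \<le> c g}"
    then obtain c d where "u = (\<Sum>g\<in>G. c g *\<^sub>R g)" "\<forall>g\<in>G. 0 \<le> c g"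
      "v = (\<Sum>g\<in>G. d g *\<^sub>R g)" "\<forall>g\<in>G. 0 \<le> d g" by blast
    then show "u + v \<in> {\<Sum>g\<in>G. c g *\<^sub>R g | c. \<forall>g\<in>G. 0 \<le> c g}"
      by (intro CollectI exI[of _ "\<lambda>g. c g + d g"]) (auto simp: scaleR_add_left sum.distrib)
  next
    fix v and t :: real
    assume "v \<in> {\<Sum>g\<in>G. c g *\<^sub>R g | c. \<forall>g\<in>G. 0 \<le> c g}" "0 \<le> t"
    then obtain c where "v = (\<Sum>g\<in>G. c g *\<^sub>R g)" "\<forall>g\<in>G. 0 \<le> c g" by blast
    then show "t *\<^sub>R v \<in> {\<Sum>g\<in>G. c g *\<^sub>R g | c. \<forall>g\<in>G. 0 \<le> c g}"
      using \<open>0 \<le> t\<close> by (intro CollectI exI[of _ "\<lambda>g. t * c g"]) (auto simp: scaleR_right.sum)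
  qed
next
  fix T assume "G \<subseteq> T" "convex_cone T"
  then show "{\<Sum>g\<in>G. c g *\<^sub>R g | c. \<forall>g\<in>G. 0 \<le> c g} \<subseteq> T"
    by (auto intro!: convex_cone_sum convex_cone_scaleR)
qed

lemma nonzero_coefficient:
  fixes v :: "'a::real_vector"
  assumes "v = (\<Sum>g\<in>G. c g *\<^sub>R g)" "v \<noteq> 0"
  obtains g where "g \<in> G" "c g \<noteq> 0"
proof -
  have "\<not> (\<forall>g\<in>G. c g = 0)"
  proof
    assume "\<forall>g\<in>G. c g = 0"
    then have "v = 0" unfolding assms(1) by (intro sum.neutral) simp
    then show False using assms(2) by simp
  qed
  then show ?thesis using that by blast
qed

lemma simplicial_cone_iff:
  assumes G: "independent G" "finite G"
  shows "v \<in> convex_cone hull G \<longleftrightarrow> v \<in> span G \<and> (\<forall>g\<in>G. 0 \<le> representation G v g)"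
proof
  let ?K = "{v \<in> span G. \<forall>g\<in>G. 0 \<le> representation G v g}"
  have "convex_cone ?K"
    unfolding convex_cone_iff
    by (auto simp: span_zero representation_zero representation_add[OF G(1)]
        representation_scale[OF G(1)] span_add span_scale)
  moreover have "G \<subseteq> ?K"
    by (auto simp: span_base representation_basis[OF G(1)])
  ultimately have "convex_cone hull G \<subseteq> ?K" by (intro hull_minimal)
  then show "v \<in> convex_cone hull G \<Longrightarrow> v \<in> span G \<and> (\<forall>g\<in>G. 0 \<le> representation G v g)"
    by blast
next
  assume v: "v \<in> span G \<and> (\<forall>g\<in>G. 0 \<le> representation G v g)"
  then have "(\<Sum>g\<in>G. representation G v g *\<^sub>R g) = v"
    using sum_representation_eq[OF G(1) _ G(2) subset_refl] by blast
  then show "v \<in> convex_cone hull G"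
    unfolding convex_cone_hull_finite[OF G(2)] using v
    by (intro CollectI exI[of _ "representation G v"]) auto
qed

text \<open>
  The sum \<open>u + v\<close> is the midpoint of \<open>2u\<close> and \<open>2v\<close>, which lie in the cone \<open>C\<close>.
\<close>

lemma face_of_cone_summand:
  assumes face: "T face_of C" and C: "convex_cone C" and T: "convex_cone T"
    and u: "u \<in> C" and v: "v \<in> C" and uv: "u + v \<in> T"
  shows "u \<in> T"
proof (cases "u = v")
  case True
  then have "(1/2) *\<^sub>R (u + v) = u" by (simp flip: scaleR_2)
  then show ?thesis using convex_cone_scaleR[OF T _ uv, of "1/2"] by simp
next
  case False
  have "u + v = (1 - 1/2) *\<^sub>R (2 *\<^sub>R u) + (1/2) *\<^sub>R (2 *\<^sub>R v)" by simp
  then have "u + v \<in> open_segment (2 *\<^sub>R u) (2 *\<^sub>R v)"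
    using False unfolding in_segment by (intro conjI exI[of _ "1/2"]) auto
  moreover have "2 *\<^sub>R u \<in> C" "2 *\<^sub>R v \<in> C" using u v by (auto intro: convex_cone_scaleR[OF C])
  ultimately have "2 *\<^sub>R u \<in> T" using face_ofD[OF face _ _ _ uv] by blast
  then show ?thesis using convex_cone_scaleR[OF T, of "1/2" "2 *\<^sub>R u"] by simp
qed

text \<open>
  Simplicial cones are cut out by linear coordinate conditions, so that a limit along a segment can
  be taken in each coordinate without any topology on the space.
\<close>

lemma simplicial_cone_closed_along_segment:
  assumes G: "independent G" "finite G" and inf: "infinite N"
    and N: "\<And>n. n \<in> N \<Longrightarrow> v + inverse (real (Suc n)) *\<^sub>R w \<in> convex_cone hull G"
  shows "v \<in> convex_cone hull G"
proof -
  let ?t = "\<lambda>n. inverse (real (Suc n))"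
  have span: "v + ?t n *\<^sub>R w \<in> span G" if "n \<in> N" for n
    using N[OF that] simplicial_cone_iff[OF G] by blast
  obtain m where m: "m \<in> N" using inf by (metis finite.emptyI equals0I)
  obtain n where n: "n \<in> N" "m < n" using inf by (auto simp: infinite_nat_iff_unbounded)
  have t: "?t m - ?t n \<noteq> 0" using n(2) by simp
  have "(v + ?t m *\<^sub>R w) - (v + ?t n *\<^sub>R w) \<in> span G" using span m n(1) by (intro span_diff)
  then have "inverse (?t m - ?t n) *\<^sub>R ((v + ?t m *\<^sub>R w) - (v + ?t n *\<^sub>R w)) \<in> span G"
    by (rule span_scale)
  moreover have "(v + ?t m *\<^sub>R w) - (v + ?t n *\<^sub>R w) = (?t m - ?t n) *\<^sub>R w"
    by (simp add: scaleR_diff_left)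
  ultimately have w: "w \<in> span G" using t by (simp del: of_nat_Suc)
  have "(v + ?t m *\<^sub>R w) - ?t m *\<^sub>R w \<in> span G" using span[OF m] w by (intro span_diff span_scale)
  then have v: "v \<in> span G" by simp
  have "0 \<le> representation G v g" if g: "g \<in> G" for g
  proof (rule ccontr)
    let ?a = "representation G v g" and ?b = "representation G w g"
    assume "\<not> 0 \<le> ?a"
    then have a: "?a < 0" by simp
    obtain k :: nat where k: "\<bar>?b\<bar> / - ?a < real k" using reals_Archimedean2 by blast
    obtain n where n: "n \<in> N" "k < n" using inf by (auto simp: infinite_nat_iff_unbounded)
    have "0 \<le> representation G (v + ?t n *\<^sub>R w) g"
      using N[OF n(1)] simplicial_cone_iff[OF G] g by blast
    then have "0 \<le> ?a + ?t n * ?b"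
      by (simp add: representation_add[OF G(1)] representation_scale[OF G(1)] v w span_scale)
    then have "0 \<le> real (Suc n) * (?a + ?t n * ?b)" by (intro mult_nonneg_nonneg) auto
    also have "\<dots> = real (Suc n) * ?a + ?b" by (simp add: distrib_left field_simps)
    finally have "- ?a * real (Suc n) \<le> \<bar>?b\<bar>" by (simp add: mult.commute)
    then have "real (Suc n) \<le> \<bar>?b\<bar> / - ?a" using a by (simp add: field_simps)
    then show False using k n(2) by linarith
  qed
  then show ?thesis using v simplicial_cone_iff[OF G] by blast
qed

text \<open>
  All coordinates of \<open>\<Sum>G\<close> are \<open>1\<close>, so a small multiple of \<open>w\<close> cannot make any of them negative.
\<close>

lemma simplicial_cone_absorbs_direction:
  assumes G: "independent G" "finite G" and span: "span G = UNIV"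
  obtains t where "t > 0" "\<Sum>G + t *\<^sub>R w \<in> convex_cone hull G"
proof -
  define s where "s = 1 + (\<Sum>g\<in>G. \<bar>representation G w g\<bar>)"
  have s: "s > 0" "\<bar>representation G w g\<bar> \<le> s" if "g \<in> G" for g
    using member_le_sum[OF that, of "\<lambda>g. \<bar>representation G w g\<bar>"] G(2)
    by (auto simp: s_def add_pos_nonneg sum_nonneg)
  have s0: "s > 0" by (simp add: s_def add_pos_nonneg sum_nonneg)
  have rep1: "representation G (\<Sum>G) g = 1" if "g \<in> G" for g
  proof -
    have "representation G (\<Sum>G) g = (\<Sum>h\<in>G. representation G h g)"
      using representation_sum[OF G(1), of G "\<lambda>h. h"] by (simp add: span)
    also have "\<dots> = (\<Sum>h\<in>G. if h = g then 1 else 0)"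
      by (intro sum.cong) (auto simp: representation_basis[OF G(1)])
    finally show ?thesis using that G(2) by simp
  qed
  have "\<Sum>G + inverse s *\<^sub>R w \<in> convex_cone hull G"
    unfolding simplicial_cone_iff[OF G]
  proof (intro conjI ballI)
    fix g assume g: "g \<in> G"
    have "representation G (\<Sum>G + inverse s *\<^sub>R w) g = 1 + inverse s * representation G w g"
      by (simp add: representation_add[OF G(1)] representation_scale[OF G(1)] span rep1[OF g])
    also have "\<dots> \<ge> 0" using s(2)[OF g] s0 by (simp add: field_simps abs_le_iff)
    finally show "0 \<le> representation G (\<Sum>G + inverse s *\<^sub>R w) g" .
  qed (simp add: span)
  then show ?thesis by (intro that[of "inverse s"]) (simp_all add: s0)
qed

text \<open>
  In a simplicial cone every basis vector spans an extreme ray, hence every generating set contains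
  a positive multiple of it. Selecting these multiples gives an independent generating subset.
\<close>

lemma simplicial_cone_generators:
  assumes G: "independent G" "finite G" and H: "finite H" "0 \<notin> H"
    and eq: "convex_cone hull G = convex_cone hull H"
  shows "\<exists>H'\<subseteq>H. independent H' \<and> convex_cone hull G = convex_cone hull H'"
proof -
  have "\<exists>h\<in>H. \<exists>t>0. h = t *\<^sub>R g" if g: "g \<in> G" for g
  proof -
    have "g \<in> convex_cone hull H" using hull_inc[OF g] eq by metis
    then obtain c where c: "g = (\<Sum>h\<in>H. c h *\<^sub>R h)" "\<forall>h\<in>H. 0 \<le> c h"
      unfolding convex_cone_hull_finite[OF H(1)] by blast
    have hC: "h \<in> span G" "\<forall>b\<in>G. 0 \<le> representation G h b" if "h \<in> H" for h
      using hull_inc[OF that, of convex_cone] simplicial_cone_iff[OF G, of h] eq by auto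
    have rep: "representation G g b = (\<Sum>h\<in>H. c h * representation G h b)" for b
    proof -
      have "representation G g b = (\<Sum>h\<in>H. representation G (c h *\<^sub>R h) b)"
        unfolding c(1) by (subst representation_sum[OF G(1)]) (auto intro: span_scale hC)
      also have "\<dots> = (\<Sum>h\<in>H. c h * representation G h b)"
        by (intro sum.cong) (auto simp: representation_scale[OF G(1) hC(1)])
      finally show ?thesis .
    qed
    have "g \<noteq> 0" using g G(1) dependent_zero by blast
    with c(1) obtain h where h: "h \<in> H" "c h \<noteq> 0" by (rule nonzero_coefficient)
    \<comment> \<open>The coordinates of \<open>g\<close> other than its own vanish and are sums of nonnegative terms.\<close>
    have zero: "representation G h b = 0" if b: "b \<in> G" "b \<noteq> g" for b
    proof -
      have "(\<Sum>h\<in>H. c h * representation G h b) = 0"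
        using rep[of b] b representation_basis[OF G(1) g] by simp
      then have "c h * representation G h b = 0"
        using sum_nonneg_eq_0_iff[OF H(1), of "\<lambda>h. c h * representation G h b"] c(2) hC b h(1) by auto
      then show ?thesis using h(2) by simp
    qed
    have "h = (\<Sum>b\<in>G. representation G h b *\<^sub>R b)"
      using sum_representation_eq[OF G(1) hC(1)[OF h(1)] G(2) subset_refl] by simp
    also have "\<dots> = (\<Sum>b\<in>G. if b = g then representation G h g *\<^sub>R g else 0)"
      by (intro sum.cong) (auto simp: zero)
    also have "\<dots> = representation G h g *\<^sub>R g" using g G(2) by simp
    finally have hg: "h = representation G h g *\<^sub>R g" .
    moreover have "representation G h g \<noteq> 0" using hg h(1) H(2) by (metis scaleR_zero_left)
    ultimately show ?thesis using h(1) hC(2)[OF h(1)] g by (metis less_le)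
  qed
  then obtain \<phi> t where \<phi>: "\<And>g. g \<in> G \<Longrightarrow> \<phi> g \<in> H \<and> t g > 0 \<and> \<phi> g = t g *\<^sub>R g" by metis
  let ?H = "\<phi> ` G"
  have sub: "?H \<subseteq> H" using \<phi> by blast
  have unscale: "inverse (t g) *\<^sub>R \<phi> g = g" if "g \<in> G" for g using \<phi>[OF that] by simp
  have "convex_cone hull G \<subseteq> convex_cone hull ?H"
  proof (intro hull_minimal convex_cone_convex_cone_hull subsetI)
    fix g assume g: "g \<in> G"
    have "inverse (t g) *\<^sub>R \<phi> g \<in> convex_cone hull ?H"
      using \<phi>[OF g] by (intro convex_cone_hull_mul hull_inc imageI g) simp
    then show "g \<in> convex_cone hull ?H" using unscale[OF g] by simp
  qed
  moreover have "convex_cone hull ?H \<subseteq> convex_cone hull G"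
    unfolding eq by (rule hull_mono[OF sub])
  moreover have "independent ?H"
  proof -
    \<comment> \<open>A maximal independent part of \<open>?H\<close> spans \<open>G\<close>, so it has at least \<open>card G\<close> elements.\<close>
    obtain B where B: "B \<subseteq> ?H" "independent B" "?H \<subseteq> span B"
      using maximal_independent_subset[of ?H] by metis
    have "G \<subseteq> span B"
    proof
      fix g assume g: "g \<in> G"
      then have "inverse (t g) *\<^sub>R \<phi> g \<in> span B" using B(3) by (intro span_scale) auto
      then show "g \<in> span B" using unscale[OF g] by simp
    qed
    moreover have finB: "finite B" using B(1) G(2) finite_subset by blast
    ultimately have "card G \<le> card B" using independent_span_bound[OF _ G(1)] by blast
    then have "card ?H \<le> card B" using card_image_le[OF G(2), of \<phi>] by simp
    then have "B = ?H" using B(1) G(2) by (intro card_seteq) auto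
    then show ?thesis using B(2) by simp
  qed
  ultimately show ?thesis using sub by blast
qed

text \<open>
  By sublinearity of \<open>p\<close>, the set where \<open>p \<le> l\<close> is a convex cone.
\<close>

lemma norm_le_functional_on_cone:
  assumes p: "is_norm p" and l: "linear l" and le: "\<And>g. g \<in> G \<Longrightarrow> p g \<le> l g"
    and v: "v \<in> convex_cone hull G"
  shows "p v \<le> l v"
proof -
  have "convex_cone {v. p v \<le> l v}"
    unfolding convex_cone_iff
    using order_trans[OF is_norm_triangle[OF p] add_mono]
    by (auto simp: linear_0[OF l] linear_add[OF l] linear_scale[OF l] is_norm_scaleR[OF p]
        is_norm_eq_0_iff[OF p, THEN iffD2] mult_left_mono)
  then have "convex_cone hull G \<subseteq> {v. p v \<le> l v}" using le by (intro hull_minimal) auto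
  then show ?thesis using v by blast
qed


section \<open>Complete simplicial fans\<close>

locale weighted_fan = weighted_directions E x
  for E :: "'a::real_normed_vector set" and x :: "'n::finite \<Rightarrow> 'a" +
  fixes F :: "'a set set"
  assumes complete: "complete_fan F"
    and simplicial: "simplicial_fan F"
    and E_fan: "E_fan E F"
begin

lemma finite_fan: "finite F"
  using complete by (simp add: complete_fan_def fan_def)

lemma face_Int: "C \<in> F \<Longrightarrow> D \<in> F \<Longrightarrow> C \<inter> D face_of C"
  using complete by (simp add: complete_fan_def fan_def)

lemma fan_covers: obtains C where "C \<in> F" "v \<in> C"
  using complete by (auto simp: complete_fan_def)

lemma ray_in_fan: "v \<in> E \<Longrightarrow> convex_cone hull {v} \<in> F"
  using E_fan by (simp add: E_fan_def)

lemma convex_cone_fan: "C \<in> F \<Longrightarrow> convex_cone C"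
  using E_fan convex_cone_convex_cone_hull by (metis E_fan_def)

lemma finite_dimensional: "finite_dimensional TYPE('a)"
  using finite_E direction_set_span[OF direction_set] by (auto simp: finite_dimensional_def)

lemma independent_finite: "independent G \<Longrightarrow> finite G" for G :: "'a set"
  using independent_span_bound[OF finite_E, of G] direction_set_span[OF direction_set] by simp

lemma fan_cone_generators:
  assumes "C \<in> F"
  obtains G where "G \<subseteq> E" "finite G" "independent G" "C = convex_cone hull G"
proof -
  obtain G where G: "independent G" "C = convex_cone hull G"
    using simplicial assms by (auto simp: simplicial_fan_def)
  obtain H where H: "H \<subseteq> E" "C = convex_cone hull H"
    using E_fan assms by (auto simp: E_fan_def)
  have "finite H" "0 \<notin> H" using H(1) finite_E finite_subset zero_notin_E by auto
  then obtain H' where "H' \<subseteq> H" "independent H'" "C = convex_cone hull H'"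
    using simplicial_cone_generators[OF G(1) independent_finite[OF G(1)], of H] G(2) H(2) by auto
  then show ?thesis using that[of H'] H(1) independent_finite by auto
qed

lemma maximal_cone_above:
  assumes "C \<in> F"
  obtains D where "maximal_cone F D" "C \<subseteq> D"
proof -
  obtain D where D: "D \<in> F" "C \<subseteq> D \<and> (\<forall>B\<in>F. D \<subseteq> B \<longrightarrow> D = B)"
    using finite_has_maximal2[OF finite_fan assms] by (rule bexE)
  have "B = D" if "B \<in> F" "D \<subseteq> B" for B using D(2) that by blast
  then have "maximal_cone F D" using D(1) by (simp add: maximal_cone_def)
  then show ?thesis using D(2) by (intro that[of D]) blast+
qed

text \<open>
  Move from the barycentre \<open>v\<close> of the generators in an arbitrary direction \<open>w\<close>. Finitely many cones
  cover the space, so one cone \<open>D\<close> contains points arbitrarily near \<open>v\<close> on this segment, and hence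
  \<open>v\<close> itself. As \<open>v\<close> is in the relative interior of \<open>C\<close>, the face \<open>C \<inter> D\<close> is all of \<open>C\<close>, and
  \<open>D = C\<close> by maximality. Therefore \<open>w\<close> lies in the span of \<open>C\<close>.
\<close>

lemma span_maximal_cone:
  assumes max: "maximal_cone F C" and G: "independent G" "C = convex_cone hull G"
  shows "span G = UNIV"
proof -
  have finG: "finite G" using independent_finite[OF G(1)] .
  have CF: "C \<in> F" using max by (simp add: maximal_cone_def)
  define v where "v = \<Sum>G"
  have "w \<in> span G" for w
  proof -
    let ?p = "\<lambda>n. v + inverse (real (Suc n)) *\<^sub>R w"
    define c where "c n = (SOME D. D \<in> F \<and> ?p n \<in> D)" for n
    have c: "c n \<in> F \<and> ?p n \<in> c n" for n
      unfolding c_def by (rule someI_ex) (use fan_covers[of "?p n"] in blast)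
    have "finite (range c)" using c finite_fan by (meson finite_subset image_subsetI)
    then obtain D where D: "D \<in> range c" "infinite (c -` {D})"
      using inf_img_fin_dom[of c UNIV] by auto
    have DF: "D \<in> F" using D(1) c by auto
    have N: "?p n \<in> D" if "n \<in> c -` {D}" for n using that c[of n] by auto
    obtain H where H: "finite H" "independent H" "D = convex_cone hull H"
      using fan_cone_generators[OF DF] by metis
    have vD: "v \<in> D"
      using simplicial_cone_closed_along_segment[OF H(2,1) D(2), of v w] N H(3) by blast
    have CD: "convex_cone (C \<inter> D)"
      using convex_cone_Inter[of "{C, D}"] convex_cone_fan CF DF by auto
    have "g \<in> D" if g: "g \<in> G" for g
    proof -
      have "v = g + \<Sum>(G - {g})" unfolding v_def using finG g by (rule sum.remove)
      moreover have "g \<in> C" "\<Sum>(G - {g}) \<in> C"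
        using g convex_cone_sum[OF convex_cone_fan[OF CF], of "G - {g}" "\<lambda>h. h"]
        unfolding G(2) by (auto intro: hull_inc)
      moreover have "v \<in> C"
        using convex_cone_sum[OF convex_cone_fan[OF CF], of G "\<lambda>h. h"]
        unfolding v_def G(2) by (auto intro: hull_inc)
      ultimately show ?thesis
        using face_of_cone_summand[OF face_Int[OF CF DF] convex_cone_fan[OF CF] CD] vD by blast
    qed
    then have "C \<subseteq> D" unfolding G(2) by (intro hull_minimal convex_cone_fan[OF DF]) blast
    then have "D = C" using max DF by (auto simp: maximal_cone_def)
    moreover obtain n where "n \<in> c -` {D}" using D(1) by auto
    ultimately have "?p n \<in> span G" "v \<in> span G"
      using N vD G(2) simplicial_cone_iff[OF G(1) finG] by auto
    then have "?p n - v \<in> span G" by (rule span_diff)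
    then have "real (Suc n) *\<^sub>R (?p n - v) \<in> span G" by (rule span_scale)
    moreover have "real (Suc n) *\<^sub>R (?p n - v) = w" by (simp del: of_nat_Suc)
    ultimately show ?thesis by simp
  qed
  then show ?thesis by blast
qed

lemma maximal_cone_basis:
  assumes "maximal_cone F C"
  obtains G where "G \<subseteq> E" "independent G" "card G = dim (UNIV :: 'a set)" "C = convex_cone hull G"
proof -
  have "C \<in> F" using assms by (simp add: maximal_cone_def)
  then obtain G where G: "G \<subseteq> E" "finite G" "independent G" "C = convex_cone hull G"
    by (rule fan_cone_generators)
  moreover have "card G = dim (UNIV :: 'a set)"
    using dim_eq_card[OF _ G(3), of UNIV] span_maximal_cone[OF assms G(3,4)] by simp
  ultimately show ?thesis by (intro that)
qed

text \<open>
  The ray of \<open>v\<close> is a face of \<open>C\<close>. In an expansion of \<open>v\<close> in the generators, every summand therefore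
  lies on this ray, and a generator with positive coefficient is a positive multiple of \<open>v\<close>. Both
  are unit vectors, so they coincide.
\<close>

lemma ray_mem_generators:
  assumes C: "C \<in> F" and G: "G \<subseteq> E" "C = convex_cone hull G" and v: "v \<in> E" "v \<in> C"
  shows "v \<in> G"
proof -
  let ?R = "convex_cone hull {v}"
  have R: "?R = {c *\<^sub>R v | c. 0 \<le> c}"
    by (subst convex_cone_hull_finite) auto
  have "?R \<subseteq> C" using v(2) by (intro hull_minimal convex_cone_fan[OF C]) auto
  then have face: "?R face_of C" using face_Int[OF C ray_in_fan[OF v(1)]] by (simp add: Int_absorb1)
  have finG: "finite G" using G(1) finite_E finite_subset by blast
  obtain c where c: "v = (\<Sum>g\<in>G. c g *\<^sub>R g)" "\<forall>g\<in>G. 0 \<le> c g"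
    using v(2) unfolding G(2) convex_cone_hull_finite[OF finG] by blast
  have "v \<noteq> 0" using v(1) zero_notin_E by blast
  with c(1) obtain g where g: "g \<in> G" "c g \<noteq> 0" by (rule nonzero_coefficient)
  then have cg: "c g > 0" using c(2) by (simp add: less_le)
  have mem: "c h *\<^sub>R h \<in> C" if "h \<in> G" for h
    unfolding G(2) using that c(2) by (intro convex_cone_hull_mul hull_inc) auto
  have "c g *\<^sub>R g + (\<Sum>h\<in>G - {g}. c h *\<^sub>R h) \<in> ?R"
    using c(1) sum.remove[OF finG g(1), of "\<lambda>h. c h *\<^sub>R h"] hull_inc[of v "{v}"] by simp
  moreover have "(\<Sum>h\<in>G - {g}. c h *\<^sub>R h) \<in> C"
    by (rule convex_cone_sum[OF convex_cone_fan[OF C]]) (simp add: mem)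
  ultimately have "c g *\<^sub>R g \<in> ?R"
    using face_of_cone_summand[OF face convex_cone_fan[OF C] convex_cone_convex_cone_hull mem[OF g(1)]]
    by simp
  then obtain t where t: "c g *\<^sub>R g = t *\<^sub>R v" "0 \<le> t" unfolding R by blast
  have "c g = t"
    using arg_cong[OF t(1), of norm] norm_E v(1) g(1) G(1) cg t(2) by auto
  then have "g = v" using t(1) cg by simp
  then show ?thesis using g(1) by simp
qed


section \<open>Admissible weights and norms linear on the cones\<close>

lemma ell_props:
  fixes G :: "'a set"
  assumes "independent G" "card G = dim (UNIV :: 'a set)"
  shows "linear (ell G w)" "\<And>g. g \<in> G \<Longrightarrow> ell G w g = w g"
  using theI'[OF ell_unique[OF finite_dimensional assms, of w]] by (auto simp: ell_def)

lemma ell_eqI: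
  fixes G :: "'a set"
  assumes "independent G" "card G = dim (UNIV :: 'a set)" "linear l" "\<And>g. g \<in> G \<Longrightarrow> l g = w g"
  shows "ell G w = l"
  unfolding ell_def using assms(3,4)
  by (intro the1_equality ell_unique[OF finite_dimensional assms(1,2)]) auto

context
  fixes w :: "'a \<Rightarrow> real"
  assumes w: "w \<in> weights_F E F"
begin

lemma weight_pos: "v \<in> E \<Longrightarrow> 0 < w v"
  using w by (auto simp: weights_F_def symmetric_weights_def)

lemma weight_minus: "v \<in> E \<Longrightarrow> w (- v) = w v"
  using w by (auto simp: weights_F_def symmetric_weights_def)

lemma multiindex_pos: "multiindex x w $ i > 0"
  by (simp add: multiindex_def weight_pos x_in_E)

lemma is_norm_rho_weight: "is_norm (rho x (multiindex x w))"
  using rho_equivalent_norm[of "multiindex x w", OF multiindex_pos] by (simp add: equivalent_norms_def)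

lemma rho_le_weight:
  assumes "v \<in> E"
  shows "rho x (multiindex x w) v \<le> w v"
proof -
  have le: "rho x (multiindex x w) (x i) \<le> w (x i)" for i
    using rho_reps_le[OF multiindex_pos, of i] by (simp add: multiindex_def)
  from assms consider i where "v = x i" | i where "v = - x i" unfolding E_eq by blast
  then show ?thesis
    using le by cases (auto simp: is_norm_minus[OF is_norm_rho_weight] weight_minus[OF x_in_E])
qed

text \<open>
  Admissibility makes the functional of a maximal cone a minorant of the gauge. On the cone it is
  also a majorant, because the gauge is sublinear and at most the weight on the generators.
\<close>

lemma rho_eq_ell:
  assumes C: "maximal_cone F C" and G: "G \<subseteq> E" "independent G" "card G = dim (UNIV :: 'a set)"
    "C = convex_cone hull G" and v: "v \<in> C"
  shows "rho x (multiindex x w) v = ell G w v"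
proof (rule antisym)
  note l = ell_props[OF G(2,3), where w = w]
  have le: "ell G w u \<le> w u" if "u \<in> E" for u
    using w C G that unfolding weights_F_def admissible_pair_def by blast
  have "\<bar>ell G w (x i)\<bar> \<le> multiindex x w $ i" for i
  proof -
    have "- x i \<in> E" by (auto simp: E_eq)
    then have "ell G w (- x i) \<le> w (- x i)" by (rule le)
    then show ?thesis
      using le[OF x_in_E[of i]] weight_minus[OF x_in_E[of i]]
      by (simp add: multiindex_def linear_neg[OF l(1)])
  qed
  then show "ell G w v \<le> rho x (multiindex x w) v"
    by (rule functional_le_rho[OF multiindex_pos l(1)])
  show "rho x (multiindex x w) v \<le> ell G w v"
  proof (rule norm_le_functional_on_cone[OF is_norm_rho_weight l(1)])
    show "v \<in> convex_cone hull G" using v G(4) by simp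
    show "rho x (multiindex x w) g \<le> ell G w g" if "g \<in> G" for g
      using that G(1) l(2) rho_le_weight by auto
  qed
qed

text \<open>
  As \<open>v\<close> is a generator of a maximal cone \<open>C\<close>, the functional of \<open>C\<close> takes the value \<open>w v\<close> there, and
  on \<open>C\<close> this functional is the gauge.
\<close>

lemma rho_eq_weight:
  assumes v: "v \<in> E"
  shows "rho x (multiindex x w) v = w v"
proof -
  obtain C where C: "maximal_cone F C" "convex_cone hull {v} \<subseteq> C"
    using maximal_cone_above[OF ray_in_fan[OF v]] by blast
  then have vC: "v \<in> C" using hull_inc[of v "{v}"] by blast
  obtain G where G: "G \<subseteq> E" "independent G" "card G = dim (UNIV :: 'a set)"
    "C = convex_cone hull G" using maximal_cone_basis[OF C(1)] by blast
  have "v \<in> G" using ray_mem_generators[OF _ G(1,4) v vC] C(1) by (simp add: maximal_cone_def)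
  then show ?thesis using rho_eq_ell[OF C(1) G vC] ell_props(2)[OF G(2,3)] by simp
qed

lemma multiindex_in_indices_E: "multiindex x w \<in> indices_E x"
  unfolding indices_E_iff by (simp add: multiindex_pos rho_eq_weight x_in_E) (simp add: multiindex_def)

lemma phi_F_in_norms_F: "phi_F x w \<in> norms_F F"
proof -
  have "\<exists>l. linear l \<and> (\<forall>v\<in>C. rho x (multiindex x w) v = l v)" if C: "C \<in> F" for C
  proof -
    obtain D where D: "maximal_cone F D" "C \<subseteq> D" using maximal_cone_above[OF C] by blast
    obtain G where G: "G \<subseteq> E" "independent G" "card G = dim (UNIV :: 'a set)"
      "D = convex_cone hull G" using maximal_cone_basis[OF D(1)] by blast
    show ?thesis using ell_props(1)[OF G(2,3)] rho_eq_ell[OF D(1) G] D(2) by blast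
  qed
  then show ?thesis
    using rho_equivalent_norm[of "multiindex x w", OF multiindex_pos]
    by (simp add: norms_F_def phi_F_def phi_E_def)
qed

lemma restrict_phi_F: "restrict (phi_F x w) E = w"
proof (rule PiE_ext[of _ E "\<lambda>_. UNIV"])
  show "w \<in> E \<rightarrow>\<^sub>E UNIV" using w by (auto simp: weights_F_def symmetric_weights_def PiE_def)
  show "restrict (phi_F x w) E v = w v" if "v \<in> E" for v
    using rho_eq_weight[OF that] that by (simp add: phi_F_def phi_E_def)
qed simp

end

text \<open>
  An extreme point of the unit ball lies in some cone, where the norm is linear. It is thus a convex
  combination of the normalised generators of the cone, and by extremality it is one of them.
\<close>

lemma norms_F_subset_norms_E: "norms_F F \<subseteq> norms_E E"
proof
  fix p assume "p \<in> norms_F F"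
  then have eq: "p \<in> equivalent_norms" and lin: "\<And>C. C \<in> F \<Longrightarrow> \<exists>l. linear l \<and> (\<forall>v\<in>C. p v = l v)"
    by (auto simp: norms_F_def)
  have p: "is_norm p" using eq by (simp add: equivalent_norms_def)
  have "v \<in> Dir E" if v: "v extreme_point_of unit_ball p" for v
  proof -
    obtain C where C: "C \<in> F" "v \<in> C" using fan_covers by blast
    obtain G where G: "G \<subseteq> E" "finite G" "C = convex_cone hull G"
      using fan_cone_generators[OF C(1)] by metis
    obtain l where l: "linear l" "\<forall>u\<in>C. p u = l u" using lin[OF C(1)] by blast
    obtain c where c: "v = (\<Sum>g\<in>G. c g *\<^sub>R g)" "\<forall>g\<in>G. 0 \<le> c g"
      using C(2) unfolding G(3) convex_cone_hull_finite[OF G(2)] by blast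
    have pos: "p g > 0" if "g \<in> G" for g
      using that G(1) zero_notin_E by (intro is_norm_pos[OF p]) auto
    have "1 = l v"
      using norm_of_extreme_point[OF p _ v, of "x undefined"] x_in_E zero_notin_E l(2) C(2) by metis
    also have "\<dots> = (\<Sum>g\<in>G. c g * l g)"
      unfolding c(1) by (simp add: linear_sum[OF l(1)] linear_scale[OF l(1)])
    also have "\<dots> = (\<Sum>g\<in>G. c g * p g)"
      using l(2) G(3) hull_inc[of _ G convex_cone] by (intro sum.cong) auto
    finally have one: "(\<Sum>g\<in>G. c g * p g) = 1" by simp
    let ?N = "(\<lambda>g. inverse (p g) *\<^sub>R g) ` G"
    have "(\<Sum>g\<in>G. (c g * p g) *\<^sub>R (inverse (p g) *\<^sub>R g)) \<in> convex hull ?N"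
      using c(2) pos by (intro convex_sum[OF G(2) convex_convex_hull one])
        (auto intro: hull_inc simp: less_imp_le)
    also have "(\<Sum>g\<in>G. (c g * p g) *\<^sub>R (inverse (p g) *\<^sub>R g)) = v"
      unfolding c(1) using pos by (intro sum.cong) (auto simp: less_imp_neq[symmetric])
    finally have "v \<in> convex hull ?N" .
    moreover have "convex hull ?N \<subseteq> unit_ball p"
      using scaled_in_unit_ball[OF p] by (intro hull_minimal convex_unit_ball[OF p]) auto
    ultimately have "v extreme_point_of convex hull ?N"
      using v unfolding extreme_point_of_def by blast
    then have "v \<in> ?N" by (rule extreme_point_of_convex_hull)
    then obtain g where "g \<in> G" "v = inverse (p g) *\<^sub>R g" by blast
    then show ?thesis using pos G(1) unfolding Dir_def by fastforce
  qed
  then show "p \<in> norms_E E" using eq by (auto simp: norms_E_def Ext_def)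
qed

text \<open>
  Let \<open>l\<close> be the functional of a maximal cone \<open>C\<close> and \<open>z\<close> the sum of the generators, an interior point
  of \<open>C\<close>. For small \<open>t > 0\<close> the point \<open>z + t v\<close> is in \<open>C\<close>, so
  \<open>l z + t l v = p (z + t v) \<le> p z + t p v = l z + t p v\<close>.
\<close>

lemma restrict_norm_in_weights_F:
  assumes "p \<in> norms_F F"
  shows "restrict p E \<in> weights_F E F"
proof -
  have p: "is_norm p" and lin: "\<And>C. C \<in> F \<Longrightarrow> \<exists>l. linear l \<and> (\<forall>v\<in>C. p v = l v)"
    using assms by (auto simp: norms_F_def equivalent_norms_def)
  have Eminus: "- v \<in> E" if "v \<in> E" for v using that by (auto simp: E_eq)
  have pos: "p v > 0" if "v \<in> E" for v
    using that zero_notin_E by (intro is_norm_pos[OF p]) auto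
  have "restrict p E \<in> symmetric_weights E"
    using pos Eminus by (auto simp: symmetric_weights_def is_norm_minus[OF p])
  moreover have "admissible_pair E F (restrict p E)"
    unfolding admissible_pair_def
  proof (intro allI impI ballI)
    fix C G v
    assume "maximal_cone F C \<and> G \<subseteq> E \<and> independent G \<and> card G = dim (UNIV :: 'a set) \<and>
      C = convex_cone hull G" and v: "v \<in> E"
    then have C: "maximal_cone F C" and G: "G \<subseteq> E" "independent G" "card G = dim (UNIV :: 'a set)"
      "C = convex_cone hull G" by auto
    have "C \<in> F" using C by (simp add: maximal_cone_def)
    then obtain l where l: "linear l" "\<forall>v\<in>C. p v = l v" using lin by blast
    have "ell G (restrict p E) = l"
      using l(2) G(1,4) hull_inc[of _ G convex_cone] by (intro ell_eqI[OF G(2,3) l(1)]) auto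
    moreover have "l v \<le> p v"
    proof -
      obtain t where t: "t > 0" "\<Sum>G + t *\<^sub>R v \<in> C"
        using simplicial_cone_absorbs_direction[OF G(2) independent_finite[OF G(2)]
            span_maximal_cone[OF C G(2,4)], of v] G(4) by blast
      have "\<Sum>G \<in> C"
        unfolding G(4) by (intro convex_cone_sum convex_cone_convex_cone_hull hull_inc)
      then have "l (\<Sum>G) + t * l v \<le> l (\<Sum>G) + t * p v"
        using is_norm_triangle[OF p, of "\<Sum>G" "t *\<^sub>R v"] l(2) t
        by (simp add: linear_add[OF l(1)] linear_scale[OF l(1)] is_norm_scaleR[OF p])
      then show ?thesis using t(1) by simp
    qed
    ultimately show "ell G (restrict p E) v \<le> restrict p E v" using v by simp
  qed
  ultimately show ?thesis by (simp add: weights_F_def)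
qed

lemma phi_F_restrict_norm:
  assumes "p \<in> norms_F F"
  shows "phi_F x (restrict p E) = p"
proof -
  have "multiindex x (restrict p E) = (\<chi> i. p (x i))"
    by (simp add: multiindex_def x_in_E)
  then show ?thesis
    using norms_E_eq_rho norms_F_subset_norms_E assms by (auto simp: phi_F_def phi_E_def)
qed

lemma bij_betw_phi_F: "bij_betw (phi_F x) (weights_F E F) (norms_F F)"
  by (rule bij_betw_byWitness[where f' = "\<lambda>p. restrict p E"])
    (auto simp: restrict_phi_F phi_F_restrict_norm phi_F_in_norms_F restrict_norm_in_weights_F)

end

theorem lemma5p2:
  fixes E :: "'a::banach set" and x :: "'n::finite \<Rightarrow> 'a" and F :: "'a set set"
  assumes "finite_dimensional TYPE('a)"
    and "direction_set E"
    and "antipodal_reps x E"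
    and "complete_fan F" and "symmetric_fan F" and "simplicial_fan F" and "E_fan E F"
  shows "multiindex x ` weights_F E F \<subseteq> indices_E x \<and>
         norms_F F \<subseteq> norms_E E \<and>
         bij_betw (phi_E x) (indices_E x) (norms_E E) \<and>
         bij_betw (phi_F x) (weights_F E F) (norms_F F)"
proof -
  interpret weighted_fan E x F
    using assms by unfold_locales
  show ?thesis
    using multiindex_in_indices_E norms_F_subset_norms_E bij_betw_phi_E bij_betw_phi_F by blast
qed

end
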